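(* Let $(G,F)$ be a similarity GIFS with $\lambda(f_e)=s^{d(e)}$ for all $e\in E$. The tiling map $T:\overleftarrow{\theta}\mapsto T(\overleftarrow{\theta})$, from the filling parameters in $\overleftarrow{\Sigma}^\infty$ (with the parameter space metric) to the tiling space $\mathbb{T}$ of balanced GIFS tilings (with the metric $d'$), is continuous. Moreover $T\circ w=W\circ T$, where $w$ is the shift map $w(\overleftarrow{\theta}_1\overleftarrow{\theta}_2\overleftarrow{\theta}_3\cdots)=\overleftarrow{\theta}_2\overleftarrow{\theta}_3\cdots$ and $W(T(\overleftarrow{\theta}))=f_{\theta_1}(T_1(\overleftarrow{\theta}))$; that is, for every filling parameter $\overleftarrow{\theta}$, $$T(w(\overleftarrow{\theta}))=f_{\theta_1}\big(T_1(\overleftarrow{\theta})\big):=\{f_{\theta_1}(t): t\in T_1(\overleftarrow{\theta})\}.$$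
   Context: GIFS. Let $G=(V,E)$ be a finite strongly connected directed graph with $V=\{1,\dots,n\}$, loops and multiple edges allowed. An edge $e$ goes from its tail $e^-$ to its head $e^+$, and $E_i=\{e\in E: e^-=i\}$. A path is directed, is written as its string of edges, may repeat vertices and edges, and may have length zero (a single vertex); $\sigma^-$ is its starting vertex and, for finite $\sigma$, $\sigma^+$ is its terminal vertex. $\Sigma^*$ is the set of finite paths in $G$. A GIFS $(G,F)$ on $\mathbb{R}^d$ consists of $G$ and an invertible contraction $f_e:\mathbb{R}^d\to\mathbb{R}^d$ for each $e\in E$. For $\sigma=\sigma_1\cdots\sigma_k\in\Sigma^*$ put $f_\sigma=f_{\sigma_1}\circ\cdots\circ f_{\sigma_k}$ (the identity if $k=0$). There is a unique $n$-tuple $(A_1,\dots,A_n)$ of nonempty compact sets (the components of the attractor) with $A_i=\bigcup_{e\in E_i}f_e(A_{e^+})$ for all $i$. Standing assumptions: each $A_i$ has nonempty interior, and for each $i$ and distinct $e,e'\in E_i$ the set $f_e(A_{e^+})\cap f_{e'}(A_{e'^+})$ has empty interior. Pre-trees. A subpath of $\sigma_1\cdots\sigma_k$ is an initial segment $\sigma_1\cdots\sigma_j$ with $0\le j\le k$ (for $j=0$, the single starting vertex); it is proper if $j<k$. A pre-tree is a finite nonempty set $S$ of finite paths in $G$ such that (i) all paths in $S$ begin at the same vertex, the root of $S$; (ii) no proper subpath of a path in $S$ lies in $S$; (iii) if $\sigma$ is a proper subpath of a path in $S$ and $e\in E$ has $e^-=\sigma^+$, then $\sigma e$ is a subpath of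 a path in $S$. Parameters. Let $\overleftarrow{G}$ be $G$ with all edges reversed, $\overleftarrow{e}$ the reversal of $e$, $\overleftarrow{\Sigma}^*$ and $\overleftarrow{\Sigma}^\infty$ the sets of finite and infinite paths in $\overleftarrow{G}$, $f_{\overleftarrow{e}}=f_e^{-1}$, and $f_{\overleftarrow{e_1}\cdots\overleftarrow{e_k}}=f_{\overleftarrow{e_1}}\circ\cdots\circ f_{\overleftarrow{e_k}}$. A parameter is an element $\overleftarrow{\theta}=\overleftarrow{\theta}_1\overleftarrow{\theta}_2\cdots$ of $\overleftarrow{\Sigma}^\infty$, with successive vertices $v_0,v_1,v_2,\dots$; $\theta_k\in E$ is the edge of $G$ with reversal $\overleftarrow{\theta}_k$ (so $\theta_k$ goes from $v_k$ to $v_{k-1}$), and $\overleftarrow{\theta}|k=\overleftarrow{\theta}_1\cdots\overleftarrow{\theta}_k$. A $\overleftarrow{\theta}$-sequence is a sequence $\mathcal{S}=\{S_0,S_1,\dots\}$ of pre-trees such that $S_k$ has root $v_k$ for all $k\ge0$ and $\theta_kS_{k-1}:=\{\theta_k\sigma:\sigma\in S_{k-1}\}\subset S_k$ for all $k\ge1$. Put $T(\overleftarrow{\theta},\mathcal{S},k)=\{f_{\overleftarrow{\theta}|k}\circ f_\sigma(A_{\sigma^+}):\sigma\in S_k\}$ and $T(\overleftarrow{\theta},\mathcal{S})=\bigcup_{k\ge0}T(\overleftarrow{\theta},\mathcal{S},k)$. The parameter $\overleftarrow{\theta}$ is filling if, for every $\overleftarrow{\theta}$-sequence $\mathcal{S}$,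 the union of the sets in $T(\overleftarrow{\theta},\mathcal{S})$ is $\mathbb{R}^d$. The parameter space metric assigns to $\sigma\ne\omega$ in $\overleftarrow{\Sigma}^\infty$ the distance $2^{-k}$, where $k$ is the first index with $\sigma_k\neq\omega_k$. Balanced tilings. Each $f_e$ is a similarity with scaling ratio $\lambda(f_e)$, and there are a fixed real $s>0$ (the scaling constant) and fixed positive integers $d(e)$ with $\lambda(f_e)=s^{d(e)}$ for all $e\in E$. Put $d(\overleftarrow{e})=d(e)$; for a finite path $\sigma$ in $G$ or $\overleftarrow{G}$, $d(\sigma)$ is the sum of the values $d(e)$ over its edges (with multiplicity), and $\sigma_*$ is the last edge of a path $\sigma\in\Sigma^*$ of positive length. The balanced sequence $\mathcal{S}(\overleftarrow{\theta})=(S_0,S_1,\dots)$ has $S_k$ equal to the set of positive-length $\sigma\in\Sigma^*$ with $\sigma^-=v_k$ and $0<d(\sigma)-d(\overleftarrow{\theta}|k)\le d(\sigma_* )$. For filling $\overleftarrow{\theta}$, the balanced GIFS tiling is $T(\overleftarrow{\theta}):=T(\overleftarrow{\theta},\mathcal{S}(\overleftarrow{\theta}))$. Level 1. $T_1(\overleftarrow{\theta})$ is the set of all $f_{\overleftarrow{\theta}|k}\circ f_\sigma(A_{\sigma^+})$ with $k\ge0$ and $\sigma\in\Sigma^*$ of positive length satisfying $\sigma^-=v_k$ and $0<d(\sigma)-d(\overleftarrow{\theta}|k)+d(\theta_1)\le d(\sigma_* )$. Tiling space. $\mathbb{T}$ is the set of all balanced GIFS tilings of $(G,F)$. Let $\rho:\mathbb{R}^d\to\mathbb{S}^d$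 be the usual (inverse) stereographic projection onto the $d$-sphere positioned at the origin. Let $\mathbb{H}(\mathbb{S}^d)$ be the set of nonempty closed subsets of $\mathbb{S}^d$ with the Hausdorff metric from the round metric. For $T,T'\in\mathbb{T}$, $d'(T,T')$ is the Hausdorff distance, relative to the metric space $\mathbb{H}(\mathbb{S}^d)$, between (the closures of) the collections $\rho(T)=\{\rho(t):t\in T\}$ and $\rho(T')=\{\rho(t):t\in T'\}$. *)

theory Defs
  imports "HOL-Analysis.Analysis" "HOL-Library.Sublist" "Graph_Theory.Graph_Theory"
begin

section \<open>Paths and pre-trees\<close>

text \<open>
  A finite path is a pair (starting vertex, arc list); the vertex is needed to tell apart the
  paths of length zero.
\<close>

type_synonym ('v, 'e) gpath = "'v \<times> 'e list"

definition finite_paths :: "('v, 'e) pre_digraph \<Rightarrow> ('v, 'e) gpath set" where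
  "finite_paths G = {(u, p). \<exists>v. pre_digraph.awalk G u p v}"

definition path_start :: "('v, 'e) gpath \<Rightarrow> 'v" where
  "path_start \<sigma> = fst \<sigma>"

definition path_end :: "('v, 'e) pre_digraph \<Rightarrow> ('v, 'e) gpath \<Rightarrow> 'v" where
  "path_end G \<sigma> = pre_digraph.awlast G (fst \<sigma>) (snd \<sigma>)"

definition proper_subpath :: "('v, 'e) gpath \<Rightarrow> ('v, 'e) gpath \<Rightarrow> bool" where
  "proper_subpath \<tau> \<sigma> \<longleftrightarrow> fst \<tau> = fst \<sigma> \<and> strict_prefix (snd \<tau>) (snd \<sigma>)"

definition subpath_of :: "('v, 'e) gpath \<Rightarrow> ('v, 'e) gpath \<Rightarrow> bool" where
  "subpath_of \<tau> \<sigma> \<longleftrightarrow> fst \<tau> = fst \<sigma> \<and> prefix (snd \<tau>) (snd \<sigma>)"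

definition append_arc :: "('v, 'e) gpath \<Rightarrow> 'e \<Rightarrow> ('v, 'e) gpath" where
  "append_arc \<sigma> e = (fst \<sigma>, snd \<sigma> @ [e])"

definition prepend_arc :: "('v, 'e) pre_digraph \<Rightarrow> 'e \<Rightarrow> ('v, 'e) gpath \<Rightarrow> ('v, 'e) gpath" where
  "prepend_arc G e \<sigma> = (tail G e, e # snd \<sigma>)"

definition pre_tree :: "('v, 'e) pre_digraph \<Rightarrow> 'v \<Rightarrow> ('v, 'e) gpath set \<Rightarrow> bool" where
  "pre_tree G r S \<longleftrightarrow>
     finite S \<and> S \<noteq> {} \<and> S \<subseteq> finite_paths G \<and>
     (\<forall>\<sigma>\<in>S. path_start \<sigma> = r) \<and>
     (\<forall>\<sigma>\<in>S. \<forall>\<tau>. proper_subpath \<tau> \<sigma> \<longrightarrow> \<tau> \<notin> S) \<and>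
     (\<forall>\<sigma>\<in>S. \<forall>\<tau>. \<forall>e\<in>arcs G. proper_subpath \<tau> \<sigma> \<and> tail G e = path_end G \<tau> \<longrightarrow>
        (\<exists>\<sigma>'\<in>S. subpath_of (append_arc \<tau> e) \<sigma>'))"


section \<open>Graph-directed systems of contractions\<close>

definition out_arcs_at :: "('v, 'e) pre_digraph \<Rightarrow> 'v \<Rightarrow> 'e set" where
  "out_arcs_at G i = {e \<in> arcs G. tail G e = i}"

definition invertible_contraction :: "('a::metric_space \<Rightarrow> 'a) \<Rightarrow> bool" where
  "invertible_contraction h \<longleftrightarrow> bij h \<and> (\<exists>c<1. c-lipschitz_on UNIV h)"

definition similarity_with_ratio :: "real \<Rightarrow> ('a::metric_space \<Rightarrow> 'a) \<Rightarrow> bool" where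
  "similarity_with_ratio r h \<longleftrightarrow> (\<forall>x y. dist (h x) (h y) = r * dist x y)"

definition GIFS :: "nat \<Rightarrow> (nat, 'e) pre_digraph \<Rightarrow> ('e \<Rightarrow> 'a::euclidean_space \<Rightarrow> 'a) \<Rightarrow> bool" where
  "GIFS n G f \<longleftrightarrow>
     fin_digraph G \<and> strongly_connected G \<and> verts G = {1..n} \<and>
     (\<forall>e\<in>arcs G. invertible_contraction (f e))"

definition attractor_components ::
  "('v, 'e) pre_digraph \<Rightarrow> ('e \<Rightarrow> 'a::euclidean_space \<Rightarrow> 'a) \<Rightarrow> ('v \<Rightarrow> 'a set) \<Rightarrow> bool" where
  "attractor_components G f A \<longleftrightarrow>
     (\<forall>i\<in>verts G. compact (A i) \<and> A i \<noteq> {} \<and>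
        A i = (\<Union>e\<in>out_arcs_at G i. f e ` A (head G e)))"

definition compose_along :: "('e \<Rightarrow> 'a \<Rightarrow> 'a) \<Rightarrow> 'e list \<Rightarrow> 'a \<Rightarrow> 'a" where
  "compose_along h p = foldr (\<lambda>e g. h e \<circ> g) p id"


section \<open>Parameters\<close>

text \<open>
  Reversal keeps the arc names, so a parameter is a sequence of arcs of \<^term>\<open>G\<close>, read as arcs
  of the reversed graph.  Sequences are indexed from 0: \<open>\<theta> 0\<close> is the first arc.
\<close>

definition reverse_graph :: "('v, 'e) pre_digraph \<Rightarrow> ('v, 'e) pre_digraph" where
  "reverse_graph G = \<lparr>verts = verts G, arcs = arcs G, tail = head G, head = tail G\<rparr>"

definition infinite_paths :: "('v, 'e) pre_digraph \<Rightarrow> (nat \<Rightarrow> 'e) set" where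
  "infinite_paths H =
     {\<theta>. (\<forall>k. \<theta> k \<in> arcs H) \<and> (\<forall>k. head H (\<theta> k) = tail H (\<theta> (Suc k)))}"

definition infinite_path_vertex :: "('v, 'e) pre_digraph \<Rightarrow> (nat \<Rightarrow> 'e) \<Rightarrow> nat \<Rightarrow> 'v" where
  "infinite_path_vertex H \<theta> k = (case k of 0 \<Rightarrow> tail H (\<theta> 0) | Suc j \<Rightarrow> head H (\<theta> j))"

definition parameters :: "('v, 'e) pre_digraph \<Rightarrow> (nat \<Rightarrow> 'e) set" where
  "parameters G = infinite_paths (reverse_graph G)"

definition param_vertex :: "('v, 'e) pre_digraph \<Rightarrow> (nat \<Rightarrow> 'e) \<Rightarrow> nat \<Rightarrow> 'v" where
  "param_vertex G \<theta> k = infinite_path_vertex (reverse_graph G) \<theta> k"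

definition param_prefix :: "(nat \<Rightarrow> 'e) \<Rightarrow> nat \<Rightarrow> 'e list" where
  "param_prefix \<theta> k = map \<theta> [0..<k]"

definition param_map :: "('e \<Rightarrow> 'a \<Rightarrow> 'a) \<Rightarrow> (nat \<Rightarrow> 'e) \<Rightarrow> nat \<Rightarrow> 'a \<Rightarrow> 'a" where
  "param_map f \<theta> k = compose_along (\<lambda>e. inv (f e)) (param_prefix \<theta> k)"

definition theta_sequence ::
  "('v, 'e) pre_digraph \<Rightarrow> (nat \<Rightarrow> 'e) \<Rightarrow> (nat \<Rightarrow> ('v, 'e) gpath set) \<Rightarrow> bool" where
  "theta_sequence G \<theta> S \<longleftrightarrow>
     (\<forall>k. pre_tree G (param_vertex G \<theta> k) (S k)) \<and>
     (\<forall>k. prepend_arc G (\<theta> k) ` S k \<subseteq> S (Suc k))"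

definition param_tile ::
  "('v, 'e) pre_digraph \<Rightarrow> ('e \<Rightarrow> 'a \<Rightarrow> 'a) \<Rightarrow> ('v \<Rightarrow> 'a set) \<Rightarrow> (nat \<Rightarrow> 'e) \<Rightarrow>
   nat \<Rightarrow> ('v, 'e) gpath \<Rightarrow> 'a set" where
  "param_tile G f A \<theta> k \<sigma> =
     (param_map f \<theta> k \<circ> compose_along f (snd \<sigma>)) ` A (path_end G \<sigma>)"

definition sequence_tiling ::
  "('v, 'e) pre_digraph \<Rightarrow> ('e \<Rightarrow> 'a \<Rightarrow> 'a) \<Rightarrow> ('v \<Rightarrow> 'a set) \<Rightarrow> (nat \<Rightarrow> 'e) \<Rightarrow>
   (nat \<Rightarrow> ('v, 'e) gpath set) \<Rightarrow> 'a set set" where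
  "sequence_tiling G f A \<theta> S = (\<Union>k. param_tile G f A \<theta> k ` S k)"

definition filling_parameters ::
  "('v, 'e) pre_digraph \<Rightarrow> ('e \<Rightarrow> 'a \<Rightarrow> 'a) \<Rightarrow> ('v \<Rightarrow> 'a set) \<Rightarrow> (nat \<Rightarrow> 'e) set" where
  "filling_parameters G f A =
     {\<theta> \<in> parameters G. \<forall>S. theta_sequence G \<theta> S \<longrightarrow> \<Union>(sequence_tiling G f A \<theta> S) = UNIV}"

text \<open>
  The exponent is the first index of disagreement counted from 1, hence the successor.
\<close>

definition param_dist :: "(nat \<Rightarrow> 'e) \<Rightarrow> (nat \<Rightarrow> 'e) \<Rightarrow> real" where
  "param_dist \<sigma> \<omega> = (if \<sigma> = \<omega> then 0 else (1/2) ^ Suc (LEAST k. \<sigma> k \<noteq> \<omega> k))"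

definition shift_map :: "(nat \<Rightarrow> 'e) \<Rightarrow> nat \<Rightarrow> 'e" where
  "shift_map \<theta> = (\<lambda>k. \<theta> (Suc k))"


section \<open>Balanced tilings\<close>

definition path_weight :: "('e \<Rightarrow> nat) \<Rightarrow> 'e list \<Rightarrow> int" where
  "path_weight wt p = (\<Sum>e\<leftarrow>p. int (wt e))"

definition balanced_sequence ::
  "('v, 'e) pre_digraph \<Rightarrow> ('e \<Rightarrow> nat) \<Rightarrow> (nat \<Rightarrow> 'e) \<Rightarrow> nat \<Rightarrow> ('v, 'e) gpath set" where
  "balanced_sequence G wt \<theta> k =
     {\<sigma> \<in> finite_paths G. snd \<sigma> \<noteq> [] \<and> path_start \<sigma> = param_vertex G \<theta> k \<and>
        0 < path_weight wt (snd \<sigma>) - path_weight wt (param_prefix \<theta> k) \<and>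
        path_weight wt (snd \<sigma>) - path_weight wt (param_prefix \<theta> k) \<le> int (wt (last (snd \<sigma>)))}"

definition balanced_tiling ::
  "('v, 'e) pre_digraph \<Rightarrow> ('e \<Rightarrow> 'a \<Rightarrow> 'a) \<Rightarrow> ('v \<Rightarrow> 'a set) \<Rightarrow> ('e \<Rightarrow> nat) \<Rightarrow>
   (nat \<Rightarrow> 'e) \<Rightarrow> 'a set set" where
  "balanced_tiling G f A wt \<theta> = sequence_tiling G f A \<theta> (balanced_sequence G wt \<theta>)"

definition level_one_tiling ::
  "('v, 'e) pre_digraph \<Rightarrow> ('e \<Rightarrow> 'a \<Rightarrow> 'a) \<Rightarrow> ('v \<Rightarrow> 'a set) \<Rightarrow> ('e \<Rightarrow> nat) \<Rightarrow>
   (nat \<Rightarrow> 'e) \<Rightarrow> 'a set set" where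
  "level_one_tiling G f A wt \<theta> =
     {param_tile G f A \<theta> k \<sigma> | k \<sigma>.
        \<sigma> \<in> finite_paths G \<and> snd \<sigma> \<noteq> [] \<and> path_start \<sigma> = param_vertex G \<theta> k \<and>
        0 < path_weight wt (snd \<sigma>) - path_weight wt (param_prefix \<theta> k) + int (wt (\<theta> 0)) \<and>
        path_weight wt (snd \<sigma>) - path_weight wt (param_prefix \<theta> k) + int (wt (\<theta> 0))
          \<le> int (wt (last (snd \<sigma>)))}"

definition tiling_space ::
  "('v, 'e) pre_digraph \<Rightarrow> ('e \<Rightarrow> 'a \<Rightarrow> 'a) \<Rightarrow> ('v \<Rightarrow> 'a set) \<Rightarrow> ('e \<Rightarrow> nat) \<Rightarrow>
   'a set set set" where
  "tiling_space G f A wt = balanced_tiling G f A wt ` filling_parameters G f A"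


section \<open>The metric on the tiling space\<close>

text \<open>
  Inverse stereographic projection from the pole \<open>(0, 1)\<close> onto the unit sphere of
  \<open>'a \<times> real\<close> centred at the origin.
\<close>

definition inverse_stereographic :: "'a::euclidean_space \<Rightarrow> 'a \<times> real" where
  "inverse_stereographic x =
     ((2 / ((norm x)\<^sup>2 + 1)) *\<^sub>R x, ((norm x)\<^sup>2 - 1) / ((norm x)\<^sup>2 + 1))"

definition round_dist :: "'b::euclidean_space \<Rightarrow> 'b \<Rightarrow> real" where
  "round_dist x y = arccos (x \<bullet> y)"

text \<open>
  Below this is only used for nonempty sets and for functions \<open>D\<close> with values in \<open>[0, pi]\<close>,
  so all suprema and infima are taken over nonempty bounded sets of reals.
\<close>

definition hausdorff_dist :: "('b \<Rightarrow> 'b \<Rightarrow> real) \<Rightarrow> 'b set \<Rightarrow> 'b set \<Rightarrow> real" where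
  "hausdorff_dist D X Y = max (SUP x\<in>X. INF y\<in>Y. D x y) (SUP y\<in>Y. INF x\<in>X. D x y)"

definition closed_subsets_of_sphere :: "('a::euclidean_space \<times> real) set set" where
  "closed_subsets_of_sphere = {X. X \<noteq> {} \<and> closed X \<and> X \<subseteq> sphere 0 1}"

definition hyperspace_closure ::
  "('a::euclidean_space \<times> real) set set \<Rightarrow> ('a \<times> real) set set" where
  "hyperspace_closure C =
     {X \<in> closed_subsets_of_sphere. \<forall>\<epsilon>>0. \<exists>Y\<in>C. hausdorff_dist round_dist X Y < \<epsilon>}"

definition tiling_dist :: "'a::euclidean_space set set \<Rightarrow> 'a set set \<Rightarrow> real" where
  "tiling_dist T T' =
     hausdorff_dist (hausdorff_dist round_dist)
       (hyperspace_closure ((\<lambda>t. inverse_stereographic ` t) ` T))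
       (hyperspace_closure ((\<lambda>t. inverse_stereographic ` t) ` T'))"

end

theory Submission
  imports Defs
begin

text \<open>
  Continuity.  Write \<open>P k\<close> for the finite patch of tiles that a filling parameter \<open>\<theta>\<close> has
  produced at stage \<open>k\<close>; the patches increase, and \<open>P k\<close> depends only on the first \<open>k\<close> arcs of
  \<open>\<theta>\<close> (for \<open>k > 0\<close>).  A parameter close to \<open>\<theta>\<close> therefore shares a late patch with it.  The
  point is that a late patch covers a large ball.  For this, note that balanced tiles are
  copies of finitely many sets under finitely many scaling ratios, so they all contain a ball
  of a fixed radius and have bounded diameter (\<open>balanced_tile_size\<close>), and that distinct tiles
  overlap in sets with empty interior (\<open>theta_sequence_tiles_disjoint_interior\<close>).  By packing,
  only finitely many tiles meet a given ball (\<open>finite_fat_sets_meeting_ball\<close>); since the tiling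
  covers the whole space, the tiles that meet the ball cover it, and they all lie in one patch
  (\<open>balanced_patch_covers_ball\<close>).  The other tiles of both tilings have no interior point in the
  covered ball, so they are far from the origin (\<open>fat_set_outside_covered_ball\<close>), and their
  images on the sphere crowd around the pole.  Hence the two projected collections are close:
  common tiles are matched with themselves, far tiles with arbitrary far tiles
  (\<open>tiling_dist_le_of_common_patch\<close>).

  The shift.  Dropping the first arc of \<open>\<theta>\<close> replaces the maps at stage \<open>k + 1\<close> by the maps at
  stage \<open>k\<close> of the shifted parameter, up to the factor \<open>f (\<theta> 0)\<close>, and lowers the weight of
  every prefix by \<open>wt (\<theta> 0)\<close>.  This is exactly the correction in the level-one condition, so
  the identity holds stage by stage (\<open>balanced_tiling_shift\<close>).  That the shifted parameter is
  again filling is the less obvious part: an arbitrary sequence of pre-trees for it has to be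
  extended backwards by one step (\<open>shift_in_filling_parameters\<close>).
\<close>


section \<open>Hausdorff distances\<close>

lemma hausdorff_dist_commute:
  assumes "\<And>x y. D x y = D y x"
  shows "hausdorff_dist D X Y = hausdorff_dist D Y X"
  unfolding hausdorff_dist_def using assms by (simp add: max.commute)

lemma hausdorff_dist_le:
  assumes ne: "X \<noteq> {}" "Y \<noteq> {}"
    and nonneg: "\<And>x y. x \<in> X \<Longrightarrow> y \<in> Y \<Longrightarrow> 0 \<le> D x y"
    and "\<And>x. x \<in> X \<Longrightarrow> \<exists>y\<in>Y. D x y \<le> e"
    and "\<And>y. y \<in> Y \<Longrightarrow> \<exists>x\<in>X. D x y \<le> e"
  shows "hausdorff_dist D X Y \<le> e"
proof -
  have "(INF y\<in>Y. D x y) \<le> e" if "x \<in> X" for x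
    using assms(4)[OF that] nonneg[OF that] by (auto intro!: cINF_lower2 bdd_belowI2[where m=0])
  moreover have "(INF x\<in>X. D x y) \<le> e" if "y \<in> Y" for y
    using assms(5)[OF that] nonneg[OF _ that] by (auto intro!: cINF_lower2 bdd_belowI2[where m=0])
  ultimately show ?thesis
    unfolding hausdorff_dist_def using ne by (auto intro!: cSUP_least)
qed

lemma inf_dist_le_hausdorff_dist:
  assumes ne: "Y \<noteq> {}" and x: "x \<in> X"
    and bnd: "\<And>x y. x \<in> X \<Longrightarrow> y \<in> Y \<Longrightarrow> 0 \<le> D x y \<and> D x y \<le> b"
  shows "(INF y\<in>Y. D x y) \<le> hausdorff_dist D X Y"
proof -
  obtain y0 where y0: "y0 \<in> Y" using ne by blast
  have "(INF y\<in>Y. D x y) \<le> b" if "x \<in> X" for x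
    using bnd[OF that] y0 by (intro cINF_lower2[OF _ y0]) (auto intro!: bdd_belowI2[where m=0])
  then have "bdd_above ((\<lambda>x. INF y\<in>Y. D x y) ` X)"
    by (intro bdd_aboveI2)
  with x have "(INF y\<in>Y. D x y) \<le> (SUP x\<in>X. INF y\<in>Y. D x y)"
    by (intro cSUP_upper)
  then show ?thesis unfolding hausdorff_dist_def by linarith
qed

lemma hausdorff_dist_nonneg:
  assumes ne: "X \<noteq> {}" "Y \<noteq> {}"
    and bnd: "\<And>x y. x \<in> X \<Longrightarrow> y \<in> Y \<Longrightarrow> 0 \<le> D x y \<and> D x y \<le> b"
  shows "0 \<le> hausdorff_dist D X Y"
proof -
  obtain x where x: "x \<in> X" using ne by blast
  have "0 \<le> (INF y\<in>Y. D x y)"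
    using ne x bnd by (intro cINF_greatest) auto
  also have "\<dots> \<le> hausdorff_dist D X Y"
    by (rule inf_dist_le_hausdorff_dist[where D = D and b = b, OF ne(2) x bnd])
  finally show ?thesis .
qed

lemma hausdorff_dist_lessD:
  assumes ne: "Y \<noteq> {}" and x: "x \<in> X"
    and bnd: "\<And>x y. x \<in> X \<Longrightarrow> y \<in> Y \<Longrightarrow> 0 \<le> D x y \<and> D x y \<le> b"
    and less: "hausdorff_dist D X Y < e"
  obtains y where "y \<in> Y" "D x y < e"
proof -
  have "(INF y\<in>Y. D x y) < e"
    using inf_dist_le_hausdorff_dist[where D = D and b = b, OF ne x bnd] less by simp
  then show ?thesis
    using that cINF_less_iff[OF ne] x bnd by (metis bdd_belowI2)
qed

text \<open>
  The triangle inequality passes from the points to the sets.  It is stated on a carrier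
  because the angular distance is a metric on the unit sphere only.
\<close>

lemma hausdorff_dist_triangle:
  assumes sub: "X \<subseteq> M" "Y \<subseteq> M" "Z \<subseteq> M"
    and ne: "X \<noteq> {}" "Y \<noteq> {}" "Z \<noteq> {}"
    and bnd: "\<And>x y. x \<in> M \<Longrightarrow> y \<in> M \<Longrightarrow> 0 \<le> D x y \<and> D x y \<le> b"
    and sym: "\<And>x y. D x y = D y x"
    and tri: "\<And>x y z. x \<in> M \<Longrightarrow> y \<in> M \<Longrightarrow> z \<in> M \<Longrightarrow> D x z \<le> D x y + D y z"
  shows "hausdorff_dist D X Z \<le> hausdorff_dist D X Y + hausdorff_dist D Y Z"
proof (rule field_le_epsilon)
  fix e :: real assume "e > 0"
  have near: "\<exists>z\<in>C. D x z \<le> hausdorff_dist D A B + hausdorff_dist D B C + e"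
    if "A \<subseteq> M" "B \<subseteq> M" "C \<subseteq> M" "B \<noteq> {}" "C \<noteq> {}" "x \<in> A" for A B C x
  proof -
    have bAB: "0 \<le> D x y \<and> D x y \<le> b" if "x \<in> A" "y \<in> B" for x y
      using bnd that \<open>A \<subseteq> M\<close> \<open>B \<subseteq> M\<close> by blast
    have bBC: "0 \<le> D x y \<and> D x y \<le> b" if "x \<in> B" "y \<in> C" for x y
      using bnd that \<open>B \<subseteq> M\<close> \<open>C \<subseteq> M\<close> by blast
    obtain y where y: "y \<in> B" "D x y < hausdorff_dist D A B + e/2"
      by (rule hausdorff_dist_lessD[where D = D and b = b and e = "hausdorff_dist D A B + e/2",
            OF \<open>B \<noteq> {}\<close> \<open>x \<in> A\<close> bAB]) (use \<open>e > 0\<close> in auto)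
    obtain z where z: "z \<in> C" "D y z < hausdorff_dist D B C + e/2"
      by (rule hausdorff_dist_lessD[where D = D and b = b and e = "hausdorff_dist D B C + e/2",
            OF \<open>C \<noteq> {}\<close> y(1) bBC]) (use \<open>e > 0\<close> in auto)
    have "D x z \<le> D x y + D y z"
      using that y z by (intro tri) auto
    then show ?thesis using y z by (intro bexI[of _ z]) auto
  qed
  show "hausdorff_dist D X Z \<le> hausdorff_dist D X Y + hausdorff_dist D Y Z + e"
  proof (rule hausdorff_dist_le[OF ne(1,3)])
    show "0 \<le> D x y" if "x \<in> X" "y \<in> Z" for x y using that sub bnd by blast
    show "\<exists>y\<in>Z. D x y \<le> hausdorff_dist D X Y + hausdorff_dist D Y Z + e" if "x \<in> X" for x
      using near[OF sub ne(2,3) that] .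
    show "\<exists>x\<in>X. D x z \<le> hausdorff_dist D X Y + hausdorff_dist D Y Z + e" if "z \<in> Z" for z
      using near[OF sub(3,2,1) ne(2,1) that]
      by (simp add: sym[of z] hausdorff_dist_commute[of D, OF sym, of Z] hausdorff_dist_commute[of D, OF sym, of Y X] add.commute)
  qed
qed


section \<open>The round metric on the sphere\<close>

lemma inner_bound_sphere:
  fixes x y :: "'b::euclidean_space"
  assumes "x \<in> sphere 0 1" "y \<in> sphere 0 1"
  shows "\<bar>x \<bullet> y\<bar> \<le> 1"
  using Cauchy_Schwarz_ineq2[of x y] assms by simp

lemma round_dist_bounds:
  assumes "x \<in> sphere 0 1" "y \<in> sphere 0 1"
  shows "0 \<le> round_dist x y \<and> round_dist x y \<le> pi"
  unfolding round_dist_def using inner_bound_sphere[OF assms]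
  by (intro conjI arccos_lbound arccos_ubound) auto

lemma round_dist_commute: "round_dist x y = round_dist y x"
  unfolding round_dist_def by (simp add: inner_commute)

lemma round_dist_self: "x \<in> sphere 0 1 \<Longrightarrow> round_dist x x = 0"
  unfolding round_dist_def by (simp add: dot_square_norm)

text \<open>
  Split \<open>x\<close> and \<open>z\<close> into their components along \<open>y\<close> and orthogonal to \<open>y\<close>.  The orthogonal
  components have lengths \<open>sin (round_dist x y)\<close> and \<open>sin (round_dist y z)\<close>, so the
  Cauchy-Schwarz inequality bounds \<open>x \<bullet> z\<close> below by the cosine of the sum of the two angles.
\<close>

lemma round_dist_triangle:
  fixes x y z :: "'b::euclidean_space"
  assumes S: "x \<in> sphere 0 1" "y \<in> sphere 0 1" "z \<in> sphere 0 1"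
  shows "round_dist x z \<le> round_dist x y + round_dist y z"
proof (cases "round_dist x y + round_dist y z \<le> pi")
  case False
  then show ?thesis using round_dist_bounds[OF S(1,3)] by linarith
next
  case True
  define a b where "a = x \<bullet> y" and "b = y \<bullet> z"
  have ab: "\<bar>a\<bar> \<le> 1" "\<bar>b\<bar> \<le> 1" unfolding a_def b_def using inner_bound_sphere S by auto
  have unit: "x \<bullet> x = 1" "y \<bullet> y = 1" "z \<bullet> z = 1" using S by (auto simp: dot_square_norm)
  define u v where "u = x - a *\<^sub>R y" and "v = z - b *\<^sub>R y"
  have nu: "norm u = sqrt (1 - a\<^sup>2)"
    unfolding norm_eq_sqrt_inner u_def using unit
    by (simp add: inner_diff_left inner_diff_right a_def inner_commute power2_eq_square)
  have nv: "norm v = sqrt (1 - b\<^sup>2)"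
    unfolding norm_eq_sqrt_inner v_def using unit
    by (simp add: inner_diff_left inner_diff_right b_def inner_commute power2_eq_square)
  have "x \<bullet> z - a * b = u \<bullet> v"
    unfolding u_def v_def using unit
    by (simp add: inner_diff_left inner_diff_right a_def b_def inner_commute algebra_simps)
  moreover have "- (norm u * norm v) \<le> u \<bullet> v"
    using Cauchy_Schwarz_ineq2[of u v] by linarith
  ultimately have "a * b - sqrt (1 - a\<^sup>2) * sqrt (1 - b\<^sup>2) \<le> x \<bullet> z"
    using nu nv by simp
  then have "cos (round_dist x y + round_dist y z) \<le> x \<bullet> z"
    unfolding round_dist_def cos_add using ab
    by (simp add: a_def[symmetric] b_def[symmetric] sin_arccos_abs)
  then have "arccos (x \<bullet> z) \<le> arccos (cos (round_dist x y + round_dist y z))"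
    using inner_bound_sphere[OF S(1,3)] by (intro arccos_le_arccos) auto
  also have "\<dots> = round_dist x y + round_dist y z"
    using True round_dist_bounds[OF S(1,2)] round_dist_bounds[OF S(2,3)]
    by (intro arccos_cos) auto
  finally show ?thesis unfolding round_dist_def .
qed

lemma closed_subsets_of_sphereD:
  assumes "X \<in> closed_subsets_of_sphere"
  shows "X \<subseteq> sphere 0 1" "X \<noteq> {}"
  using assms unfolding closed_subsets_of_sphere_def by auto

lemma hausdorff_round_nonneg:
  assumes "X \<in> closed_subsets_of_sphere" "Y \<in> closed_subsets_of_sphere"
  shows "0 \<le> hausdorff_dist round_dist X Y"
proof (rule hausdorff_dist_nonneg[where b = pi])
  show "X \<noteq> {}" "Y \<noteq> {}" using assms closed_subsets_of_sphereD by auto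
  show "0 \<le> round_dist x y \<and> round_dist x y \<le> pi" if "x \<in> X" "y \<in> Y" for x y
    using that assms closed_subsets_of_sphereD by (intro round_dist_bounds) blast+
qed

lemma hausdorff_round_commute:
  "hausdorff_dist round_dist X Y = hausdorff_dist round_dist Y X"
  by (rule hausdorff_dist_commute[OF round_dist_commute])

lemma hausdorff_round_triangle:
  assumes "X \<in> closed_subsets_of_sphere" "Y \<in> closed_subsets_of_sphere"
    and "Z \<in> closed_subsets_of_sphere"
  shows "hausdorff_dist round_dist X Z
    \<le> hausdorff_dist round_dist X Y + hausdorff_dist round_dist Y Z"
proof (rule hausdorff_dist_triangle[where M = "sphere 0 1" and b = pi])
  show "X \<subseteq> sphere 0 1" "Y \<subseteq> sphere 0 1" "Z \<subseteq> sphere 0 1"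
    by (rule closed_subsets_of_sphereD(1)[OF assms(1)] closed_subsets_of_sphereD(1)[OF assms(2)]
        closed_subsets_of_sphereD(1)[OF assms(3)])+
  show "X \<noteq> {}" "Y \<noteq> {}" "Z \<noteq> {}"
    by (rule closed_subsets_of_sphereD(2)[OF assms(1)] closed_subsets_of_sphereD(2)[OF assms(2)]
        closed_subsets_of_sphereD(2)[OF assms(3)])+
qed (rule round_dist_bounds round_dist_commute round_dist_triangle; assumption?)+

lemma hausdorff_round_self:
  assumes "X \<in> closed_subsets_of_sphere"
  shows "hausdorff_dist round_dist X X \<le> 0"
proof (rule hausdorff_dist_le)
  have S: "x \<in> sphere 0 1" if "x \<in> X" for x
    using closed_subsets_of_sphereD(1)[OF assms] that by blast
  show "X \<noteq> {}" "X \<noteq> {}" using closed_subsets_of_sphereD(2)[OF assms] by auto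
  show "0 \<le> round_dist x y" if "x \<in> X" "y \<in> X" for x y
    using round_dist_bounds[OF S S] that by blast
  show "\<exists>y\<in>X. round_dist x y \<le> 0" if "x \<in> X" for x
    using round_dist_self[OF S[OF that]] that by (intro bexI[of _ x]) auto
  then show "\<exists>y\<in>X. round_dist y x \<le> 0" if "x \<in> X" for x
    using that by (subst round_dist_commute)
qed

lemma subset_hyperspace_closure:
  assumes "C \<subseteq> closed_subsets_of_sphere"
  shows "C \<subseteq> hyperspace_closure C"
proof
  fix X assume "X \<in> C"
  then have "\<exists>Y\<in>C. hausdorff_dist round_dist X Y < e" if "e > 0" for e
    using assms hausdorff_round_self[of X] that by (intro bexI[of _ X]) auto
  then show "X \<in> hyperspace_closure C"
    unfolding hyperspace_closure_def using assms \<open>X \<in> C\<close> by auto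
qed

text \<open>
  Members of a closure are limits of members of the collection, so the triangle inequality gives
  the bound \<open>e + \<epsilon>\<close> for every positive \<open>\<epsilon>\<close>.  Hence it suffices to match the sets of the two
  collections themselves.
\<close>

lemma hausdorff_dist_hyperspace_closure_le:
  fixes C C' :: "('a::euclidean_space \<times> real) set set"
  assumes C: "C \<subseteq> closed_subsets_of_sphere" "C \<noteq> {}"
    and C': "C' \<subseteq> closed_subsets_of_sphere" "C' \<noteq> {}"
    and near: "\<And>X. X \<in> C \<Longrightarrow> \<exists>Y\<in>C'. hausdorff_dist round_dist X Y \<le> e"
    and near': "\<And>Y. Y \<in> C' \<Longrightarrow> \<exists>X\<in>C. hausdorff_dist round_dist Y X \<le> e"
  shows "hausdorff_dist (hausdorff_dist round_dist) (hyperspace_closure C) (hyperspace_closure C')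
    \<le> e"
proof (rule field_le_epsilon)
  fix \<epsilon> :: real assume "\<epsilon> > 0"
  have approx: "\<exists>Y\<in>hyperspace_closure Q. hausdorff_dist round_dist X Y \<le> e + \<epsilon>"
    if P: "P \<subseteq> closed_subsets_of_sphere" and Q: "Q \<subseteq> closed_subsets_of_sphere"
      and PQ: "\<And>X. X \<in> P \<Longrightarrow> \<exists>Y\<in>Q. hausdorff_dist round_dist X Y \<le> e"
      and X: "X \<in> hyperspace_closure P"
    for P Q :: "('a \<times> real) set set" and X
  proof -
    obtain X' where X': "X' \<in> P" "hausdorff_dist round_dist X X' < \<epsilon>"
      using X \<open>\<epsilon> > 0\<close> unfolding hyperspace_closure_def by blast
    obtain Y where Y: "Y \<in> Q" "hausdorff_dist round_dist X' Y \<le> e"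
      using PQ[OF X'(1)] by blast
    have "hausdorff_dist round_dist X Y \<le> e + \<epsilon>"
      using hausdorff_round_triangle[of X X' Y] X X' Y P Q
      unfolding hyperspace_closure_def by force
    moreover have "Y \<in> hyperspace_closure Q"
      using subset_hyperspace_closure[OF Q] Y by blast
    ultimately show ?thesis by blast
  qed
  show "hausdorff_dist (hausdorff_dist round_dist) (hyperspace_closure C) (hyperspace_closure C')
    \<le> e + \<epsilon>"
  proof (rule hausdorff_dist_le)
    show "hyperspace_closure C \<noteq> {}" using subset_hyperspace_closure[OF C(1)] C(2) by auto
    show "hyperspace_closure C' \<noteq> {}" using subset_hyperspace_closure[OF C'(1)] C'(2) by auto
    show "0 \<le> hausdorff_dist round_dist X Y"
      if "X \<in> hyperspace_closure C" "Y \<in> hyperspace_closure C'" for X Y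
      using that hausdorff_round_nonneg unfolding hyperspace_closure_def by blast
    show "\<exists>Y\<in>hyperspace_closure C'. hausdorff_dist round_dist X Y \<le> e + \<epsilon>"
      if "X \<in> hyperspace_closure C" for X
      using approx[OF C(1) C'(1) near that] .
    show "\<exists>X\<in>hyperspace_closure C. hausdorff_dist round_dist X Y \<le> e + \<epsilon>"
      if "Y \<in> hyperspace_closure C'" for Y
      using approx[OF C'(1) C(1) near' that] by (simp add: hausdorff_round_commute)
  qed
qed


section \<open>Stereographic projection far from the origin\<close>

lemma inverse_stereographic_in_sphere: "inverse_stereographic x \<in> sphere 0 1"
proof -
  define q where "q = (norm x)\<^sup>2"
  have "q \<ge> 0" unfolding q_def by simp
  then have "q + 1 \<noteq> 0" by linarith
  have "inverse_stereographic x \<bullet> inverse_stereographic x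
      = (2 / (q + 1))\<^sup>2 * q + ((q - 1) / (q + 1))\<^sup>2"
    unfolding inverse_stereographic_def inner_Pair q_def
    by (simp add: power2_eq_square dot_square_norm)
  also have "\<dots> = (4 * q + (q - 1)\<^sup>2) / (q + 1)\<^sup>2"
    by (simp add: power_divide add_divide_distrib)
  also have "4 * q + (q - 1)\<^sup>2 = (q + 1)\<^sup>2"
    by (simp add: power2_eq_square algebra_simps)
  finally have "(norm (inverse_stereographic x))\<^sup>2 = 1"
    using \<open>q + 1 \<noteq> 0\<close> by (simp add: dot_square_norm)
  then have "norm (inverse_stereographic x) = 1"
    using norm_ge_zero[of "inverse_stereographic x"] by (simp add: power2_eq_1_iff)
  then show ?thesis by simp
qed

lemma continuous_on_inverse_stereographic: "continuous_on S inverse_stereographic"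
proof -
  have "(norm x)\<^sup>2 + 1 \<noteq> 0" for x :: 'a
    using zero_le_power2[of "norm x"] by linarith
  then show ?thesis
    unfolding inverse_stereographic_def by (intro continuous_intros) auto
qed

lemma inverse_stereographic_image_closed:
  assumes "compact t" "t \<noteq> {}"
  shows "inverse_stereographic ` t \<in> closed_subsets_of_sphere"
  unfolding closed_subsets_of_sphere_def
  using assms inverse_stereographic_in_sphere
    compact_imp_closed[OF compact_continuous_image[OF continuous_on_inverse_stereographic]]
  by auto

text \<open>
  The height of the projected point is \<open>1 - 2 / ((norm x)\<^sup>2 + 1)\<close>, and its angle to the pole is
  at most \<open>\<eta>\<close> as soon as this height is at least \<open>cos \<eta>\<close>.
\<close>

lemma inverse_stereographic_near_pole:
  assumes "\<eta> > 0"
  obtains M where "\<And>x :: 'a::euclidean_space.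
    norm x \<ge> M \<Longrightarrow> round_dist (inverse_stereographic x) (0, 1) \<le> \<eta>"
proof -
  define \<eta>' where "\<eta>' = min \<eta> pi"
  have \<eta>': "0 < \<eta>'" "\<eta>' \<le> pi" "\<eta>' \<le> \<eta>" using assms unfolding \<eta>'_def by auto
  define c where "c = 1 - cos \<eta>'"
  have "cos \<eta>' < cos 0" using \<eta>' by (intro cos_monotone_0_pi) auto
  then have "c > 0" unfolding c_def by simp
  show ?thesis
  proof (rule that)
    fix x :: 'a
    assume "norm x \<ge> sqrt (2 / c)"
    then have "(sqrt (2 / c))\<^sup>2 \<le> (norm x)\<^sup>2"
      using \<open>c > 0\<close> by (intro power_mono) auto
    then have "2 / c \<le> (norm x)\<^sup>2" using \<open>c > 0\<close> by simp
    define q where "q = (norm x)\<^sup>2"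
    have q: "q \<ge> 0" "2 / c \<le> q" unfolding q_def using \<open>2 / c \<le> (norm x)\<^sup>2\<close> by auto
    then have "2 \<le> c * (q + 1)"
      using \<open>c > 0\<close> by (simp add: divide_simps algebra_simps)
    then have "2 / (q + 1) \<le> c" using q by (simp add: divide_simps)
    moreover have "(q - 1) / (q + 1) = 1 - 2 / (q + 1)"
      using q by (simp add: divide_simps)
    ultimately have "cos \<eta>' \<le> (q - 1) / (q + 1)" unfolding c_def by linarith
    moreover have "(q - 1) / (q + 1) \<le> 1" using q by (simp add: divide_simps)
    ultimately have "arccos ((q - 1) / (q + 1)) \<le> arccos (cos \<eta>')"
      by (intro arccos_le_arccos) auto
    also have "\<dots> = \<eta>'" using \<eta>' by (intro arccos_cos) auto
    finally show "round_dist (inverse_stereographic x) (0, 1) \<le> \<eta>"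
      using \<eta>' unfolding round_dist_def inverse_stereographic_def q_def by simp
  qed
qed

text \<open>
  All points far from the origin project close to the pole, and therefore close to each other.
\<close>

lemma hausdorff_dist_far_sets:
  assumes "\<eta> > 0"
  obtains M where "\<And>t t' :: 'a::euclidean_space set. t \<noteq> {} \<Longrightarrow> t' \<noteq> {} \<Longrightarrow>
    (\<And>x. x \<in> t \<union> t' \<Longrightarrow> norm x \<ge> M) \<Longrightarrow>
    hausdorff_dist round_dist (inverse_stereographic ` t) (inverse_stereographic ` t') \<le> \<eta>"
proof -
  obtain M where M: "\<And>x :: 'a. norm x \<ge> M \<Longrightarrow>
      round_dist (inverse_stereographic x) (0, 1) \<le> \<eta> / 2"
    using inverse_stereographic_near_pole[of "\<eta> / 2"] assms by auto
  have near: "round_dist (inverse_stereographic x) (inverse_stereographic y) \<le> \<eta>"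
    if "norm x \<ge> M" "norm y \<ge> M" for x y :: 'a
  proof -
    have "round_dist (inverse_stereographic x) (inverse_stereographic y)
        \<le> round_dist (inverse_stereographic x) (0, 1) + round_dist (0, 1) (inverse_stereographic y)"
      by (intro round_dist_triangle inverse_stereographic_in_sphere) (simp add: norm_Pair)
    then show ?thesis
      using M[OF that(1)] M[OF that(2)] round_dist_commute[of "(0, 1)" "inverse_stereographic y"]
      by linarith
  qed
  show ?thesis
  proof (rule that)
    fix t t' :: "'a set"
    assume ne: "t \<noteq> {}" "t' \<noteq> {}" and far: "\<And>x. x \<in> t \<union> t' \<Longrightarrow> norm x \<ge> M"
    obtain x0 y0 where xy0: "x0 \<in> t" "y0 \<in> t'" using ne by blast
    show "hausdorff_dist round_dist (inverse_stereographic ` t) (inverse_stereographic ` t') \<le> \<eta>"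
    proof (rule hausdorff_dist_le)
      show "0 \<le> round_dist x y"
        if "x \<in> inverse_stereographic ` t" "y \<in> inverse_stereographic ` t'" for x y
        using that round_dist_bounds[OF inverse_stereographic_in_sphere inverse_stereographic_in_sphere]
        by blast
      show "\<exists>y\<in>inverse_stereographic ` t'. round_dist x y \<le> \<eta>"
        if "x \<in> inverse_stereographic ` t" for x
        using that far near xy0 by (intro bexI[of _ "inverse_stereographic y0"]) auto
      show "\<exists>x\<in>inverse_stereographic ` t. round_dist x y \<le> \<eta>"
        if "y \<in> inverse_stereographic ` t'" for y
        using that far near xy0 by (intro bexI[of _ "inverse_stereographic x0"]) auto
    qed (use ne in auto)
  qed
qed


section \<open>Paths and pre-trees\<close>

lemma compose_along_simps [simp]:
  "compose_along h [] = id"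
  "compose_along h (e # p) = h e \<circ> compose_along h p"
  unfolding compose_along_def by simp_all

lemma compose_along_append: "compose_along h (p @ q) = compose_along h p \<circ> compose_along h q"
  by (induction p) (simp_all add: comp_assoc)

lemma snd_append_arc [simp]: "snd (append_arc \<sigma> e) = snd \<sigma> @ [e]"
  and fst_append_arc [simp]: "fst (append_arc \<sigma> e) = fst \<sigma>"
  and snd_prepend_arc [simp]: "snd (prepend_arc G e \<sigma>) = e # snd \<sigma>"
  and fst_prepend_arc [simp]: "fst (prepend_arc G e \<sigma>) = tail G e"
  unfolding append_arc_def prepend_arc_def by simp_all

context wf_digraph
begin

lemma finite_paths_iff: "\<sigma> \<in> finite_paths G \<longleftrightarrow> awalk (fst \<sigma>) (snd \<sigma>) (path_end G \<sigma>)"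
  unfolding finite_paths_def path_end_def by (cases \<sigma>) auto

lemma path_end_in_verts: "\<sigma> \<in> finite_paths G \<Longrightarrow> path_end G \<sigma> \<in> verts G"
  by (auto simp: finite_paths_iff)

lemma path_end_append_arc [simp]: "path_end G (append_arc \<sigma> e) = head G e"
  unfolding path_end_def by (simp add: awlast_append)

lemma append_arc_in_finite_paths:
  assumes "\<sigma> \<in> finite_paths G" "e \<in> arcs G" "tail G e = path_end G \<sigma>"
  shows "append_arc \<sigma> e \<in> finite_paths G"
  using assms unfolding finite_paths_iff
  by (auto simp: awalk_Cons_iff path_end_def awlast_append awalk_Nil_iff)

lemma path_end_prepend_arc:
  assumes "fst \<sigma> = head G e"
  shows "path_end G (prepend_arc G e \<sigma>) = path_end G \<sigma>"
  using assms unfolding path_end_def by simp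

lemma prepend_arc_in_finite_paths:
  assumes "\<sigma> \<in> finite_paths G" "e \<in> arcs G" "fst \<sigma> = head G e"
  shows "prepend_arc G e \<sigma> \<in> finite_paths G"
  using assms path_end_prepend_arc[OF assms(3)] unfolding finite_paths_iff
  by (simp add: awalk_Cons_iff)

definition refine_pre_tree :: "('a, 'b) gpath set \<Rightarrow> ('a, 'b) gpath set" where
  "refine_pre_tree S =
     {append_arc \<sigma> e | \<sigma> e. \<sigma> \<in> S \<and> e \<in> arcs G \<and> tail G e = path_end G \<sigma>}"

definition branch_of_pre_tree :: "'b \<Rightarrow> ('a, 'b) gpath set \<Rightarrow> ('a, 'b) gpath set" where
  "branch_of_pre_tree e S = {\<sigma>. fst \<sigma> = head G e \<and> prepend_arc G e \<sigma> \<in> S}"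

text \<open>
  If the trivial path belongs to \<open>S\<close>, it is the only element, and nothing of \<open>S\<close> follows the
  arc \<open>e\<close>.  Otherwise the trivial path is a proper initial segment, and completeness of \<open>S\<close>
  there yields a path that starts with \<open>e\<close>; so the branch is nonempty, while its other
  properties are inherited by prepending \<open>e\<close>.
\<close>

lemma pre_tree_branch:
  assumes S: "pre_tree G r S" and e: "e \<in> arcs G" "tail G e = r" and nontriv: "(r, []) \<notin> S"
  shows "pre_tree G (head G e) (branch_of_pre_tree e S)"
proof -
  have S_paths: "S \<subseteq> finite_paths G" and S_root: "\<And>\<sigma>. \<sigma> \<in> S \<Longrightarrow> fst \<sigma> = r"
    and S_antichain: "\<And>\<sigma> \<tau>. \<sigma> \<in> S \<Longrightarrow> proper_subpath \<tau> \<sigma> \<Longrightarrow> \<tau> \<notin> S"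
    and S_complete: "\<And>\<sigma> \<tau> a. \<sigma> \<in> S \<Longrightarrow> a \<in> arcs G \<Longrightarrow> proper_subpath \<tau> \<sigma> \<Longrightarrow>
      tail G a = path_end G \<tau> \<Longrightarrow> \<exists>\<sigma>'\<in>S. subpath_of (append_arc \<tau> a) \<sigma>'"
    using S unfolding pre_tree_def path_start_def by blast+
  have lift: "\<exists>\<sigma>'\<in>branch_of_pre_tree e S. prefix q (snd \<sigma>')"
    if "\<sigma> \<in> S" "prefix (e # q) (snd \<sigma>)" for \<sigma> q
  proof -
    obtain p where p: "snd \<sigma> = e # q @ p"
      using \<open>prefix (e # q) (snd \<sigma>)\<close> by (auto simp: prefix_def)
    have "prepend_arc G e (head G e, q @ p) = \<sigma>"
      using p S_root[OF that(1)] e by (cases \<sigma>) (simp add: prepend_arc_def)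
    then show ?thesis
      using that(1) unfolding branch_of_pre_tree_def
      by (intro bexI[of _ "(head G e, q @ p)"]) auto
  qed
  have "branch_of_pre_tree e S \<subseteq> (\<lambda>\<sigma>. (head G e, tl (snd \<sigma>))) ` S"
    unfolding branch_of_pre_tree_def by (force simp: image_iff)
  moreover have "finite S" using S unfolding pre_tree_def by blast
  ultimately have fin: "finite (branch_of_pre_tree e S)"
    using finite_surj by blast
  have ne: "branch_of_pre_tree e S \<noteq> {}"
  proof -
    obtain \<sigma> where \<sigma>: "\<sigma> \<in> S" using S unfolding pre_tree_def by blast
    then have "snd \<sigma> \<noteq> []" using nontriv S_root by (metis prod.collapse)
    then have "proper_subpath (r, []) \<sigma>"
      using S_root[OF \<sigma>] by (simp add: proper_subpath_def strict_prefix_def)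
    moreover have "tail G e = path_end G (r, [])" using e by (simp add: path_end_def)
    ultimately obtain \<sigma>' where "\<sigma>' \<in> S" "subpath_of (append_arc (r, []) e) \<sigma>'"
      using S_complete[OF \<sigma> e(1)] by blast
    then show ?thesis using lift[of \<sigma>' "[]"] by (auto simp: subpath_of_def)
  qed
  have paths: "branch_of_pre_tree e S \<subseteq> finite_paths G"
  proof
    fix \<sigma> assume "\<sigma> \<in> branch_of_pre_tree e S"
    then have "fst \<sigma> = head G e" "prepend_arc G e \<sigma> \<in> finite_paths G"
      using S_paths unfolding branch_of_pre_tree_def by auto
    then show "\<sigma> \<in> finite_paths G"
      using path_end_prepend_arc[of \<sigma> e] by (simp add: finite_paths_iff awalk_Cons_iff)
  qed
  have proper: "proper_subpath (prepend_arc G e \<tau>) (prepend_arc G e \<sigma>)"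
    if "proper_subpath \<tau> \<sigma>" for \<tau> \<sigma>
    using that unfolding proper_subpath_def by simp
  have antichain: "\<tau> \<notin> branch_of_pre_tree e S"
    if "\<sigma> \<in> branch_of_pre_tree e S" "proper_subpath \<tau> \<sigma>" for \<sigma> \<tau>
    using that S_antichain proper unfolding branch_of_pre_tree_def by blast
  have complete: "\<exists>\<sigma>'\<in>branch_of_pre_tree e S. subpath_of (append_arc \<tau> a) \<sigma>'"
    if "\<sigma> \<in> branch_of_pre_tree e S" "a \<in> arcs G" "proper_subpath \<tau> \<sigma>" "tail G a = path_end G \<tau>"
    for \<sigma> \<tau> a
  proof -
    have "fst \<tau> = head G e"
      using that unfolding branch_of_pre_tree_def proper_subpath_def by simp
    then have "tail G a = path_end G (prepend_arc G e \<tau>)"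
      using that(4) path_end_prepend_arc by simp
    moreover have "prepend_arc G e \<sigma> \<in> S" using that(1) unfolding branch_of_pre_tree_def by simp
    ultimately obtain \<sigma>' where "\<sigma>' \<in> S" "subpath_of (append_arc (prepend_arc G e \<tau>) a) \<sigma>'"
      using S_complete[OF _ \<open>a \<in> arcs G\<close> proper[OF \<open>proper_subpath \<tau> \<sigma>\<close>]] by blast
    then obtain \<sigma>'' where "\<sigma>'' \<in> branch_of_pre_tree e S" "prefix (snd \<tau> @ [a]) (snd \<sigma>'')"
      using lift[of \<sigma>' "snd \<tau> @ [a]"] by (auto simp: subpath_of_def)
    then show ?thesis
      using \<open>fst \<tau> = head G e\<close>
      by (intro bexI[of _ \<sigma>'']) (auto simp: subpath_of_def branch_of_pre_tree_def)
  qed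
  have root: "\<forall>\<sigma>\<in>branch_of_pre_tree e S. path_start \<sigma> = head G e"
    unfolding branch_of_pre_tree_def path_start_def by simp
  show ?thesis
    unfolding pre_tree_def using fin ne paths root antichain complete by blast
qed

text \<open>
  Prolonging every path by every possible arc produces a pre-tree without the trivial path, to
  which branching can be applied.
\<close>

lemma pre_tree_refine:
  assumes S: "pre_tree G r S" and out: "\<And>i. i \<in> verts G \<Longrightarrow> out_arcs_at G i \<noteq> {}"
    and fin_arcs: "finite (arcs G)"
  shows "pre_tree G r (refine_pre_tree S)"
proof -
  have S_fin: "finite S" and S_ne: "S \<noteq> {}"
    and S_paths: "\<And>\<sigma>. \<sigma> \<in> S \<Longrightarrow> \<sigma> \<in> finite_paths G" and S_root: "\<And>\<sigma>. \<sigma> \<in> S \<Longrightarrow> fst \<sigma> = r"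
    and S_antichain: "\<And>\<sigma> \<tau>. \<sigma> \<in> S \<Longrightarrow> proper_subpath \<tau> \<sigma> \<Longrightarrow> \<tau> \<notin> S"
    and S_complete: "\<And>\<sigma> \<tau> a. \<sigma> \<in> S \<Longrightarrow> a \<in> arcs G \<Longrightarrow> proper_subpath \<tau> \<sigma> \<Longrightarrow>
      tail G a = path_end G \<tau> \<Longrightarrow> \<exists>\<sigma>'\<in>S. subpath_of (append_arc \<tau> a) \<sigma>'"
    using S unfolding pre_tree_def path_start_def by blast+
  have "refine_pre_tree S \<subseteq> case_prod append_arc ` (S \<times> arcs G)"
    unfolding refine_pre_tree_def by force
  then have fin: "finite (refine_pre_tree S)"
    using S_fin fin_arcs finite_subset by blast
  have extend: "\<exists>a. append_arc \<sigma> a \<in> refine_pre_tree S" if "\<sigma> \<in> S" for \<sigma>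
  proof -
    have "out_arcs_at G (path_end G \<sigma>) \<noteq> {}"
      using S_paths[OF that] by (intro out path_end_in_verts)
    then show ?thesis using that unfolding refine_pre_tree_def out_arcs_at_def by blast
  qed
  have ne: "refine_pre_tree S \<noteq> {}" using S_ne extend by blast
  have paths: "refine_pre_tree S \<subseteq> finite_paths G"
    unfolding refine_pre_tree_def using S_paths append_arc_in_finite_paths by blast
  have root: "\<forall>\<sigma>\<in>refine_pre_tree S. path_start \<sigma> = r"
    unfolding refine_pre_tree_def path_start_def using S_root
    by (auto simp: append_arc_def)
  have antichain: "\<tau> \<notin> refine_pre_tree S"
    if "\<sigma> \<in> refine_pre_tree S" "proper_subpath \<tau> \<sigma>" for \<sigma> \<tau>
  proof
    assume "\<tau> \<in> refine_pre_tree S"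
    then obtain \<tau>' b where \<tau>: "\<tau> = append_arc \<tau>' b" "\<tau>' \<in> S"
      unfolding refine_pre_tree_def by blast
    obtain \<sigma>' a where \<sigma>: "\<sigma> = append_arc \<sigma>' a" "\<sigma>' \<in> S"
      using \<open>\<sigma> \<in> refine_pre_tree S\<close> unfolding refine_pre_tree_def by blast
    have "strict_prefix (snd \<tau>' @ [b]) (snd \<sigma>' @ [a])" "fst \<tau>' = fst \<sigma>'"
      using that(2) \<tau> \<sigma> unfolding proper_subpath_def by auto
    then have "prefix (snd \<tau>' @ [b]) (snd \<sigma>')"
      by (metis prefix_snoc strict_prefix_def)
    then have "proper_subpath \<tau>' \<sigma>'"
      unfolding proper_subpath_def using \<open>fst \<tau>' = fst \<sigma>'\<close>
      by (metis append_prefixD not_Cons_self2 self_append_conv prefix_order.less_le same_prefix_nil)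
    then show False using S_antichain \<tau> \<sigma> by blast
  qed
  have complete: "\<exists>\<sigma>'\<in>refine_pre_tree S. subpath_of (append_arc \<tau> a) \<sigma>'"
    if "\<sigma> \<in> refine_pre_tree S" "a \<in> arcs G" "proper_subpath \<tau> \<sigma>" "tail G a = path_end G \<tau>"
    for \<sigma> \<tau> a
  proof -
    obtain \<sigma>' b where \<sigma>: "\<sigma> = append_arc \<sigma>' b" "\<sigma>' \<in> S"
      using \<open>\<sigma> \<in> refine_pre_tree S\<close> unfolding refine_pre_tree_def by blast
    have pre: "prefix (snd \<tau>) (snd \<sigma>')" "fst \<tau> = fst \<sigma>'"
      using that(3) \<sigma> unfolding proper_subpath_def by (auto simp: strict_prefix_def)
    show ?thesis
    proof (cases "snd \<tau> = snd \<sigma>'")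
      case True
      then have "\<tau> = \<sigma>'" using pre by (simp add: prod_eq_iff)
      then have "append_arc \<tau> a \<in> refine_pre_tree S"
        using \<sigma> that unfolding refine_pre_tree_def by blast
      then show ?thesis
        by (intro bexI[of _ "append_arc \<tau> a"]) (auto simp: subpath_of_def)
    next
      case False
      then have "proper_subpath \<tau> \<sigma>'" using pre by (simp add: proper_subpath_def strict_prefix_def)
      then obtain \<sigma>'' where \<sigma>'': "\<sigma>'' \<in> S" "subpath_of (append_arc \<tau> a) \<sigma>''"
        using S_complete[OF \<sigma>(2) \<open>a \<in> arcs G\<close>] \<open>tail G a = path_end G \<tau>\<close> by blast
      obtain c where "append_arc \<sigma>'' c \<in> refine_pre_tree S" using extend \<sigma>''(1) by blast
      then show ?thesis
        using \<sigma>''(2) unfolding subpath_of_def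
        by (intro bexI[of _ "append_arc \<sigma>'' c"]) (auto intro: prefix_prefix)
    qed
  qed
  show ?thesis
    unfolding pre_tree_def using fin ne paths root antichain complete by blast
qed

end


section \<open>Parameters and the tiles along a parameter\<close>

lemma parametersD:
  assumes "\<theta> \<in> parameters G"
  shows "\<theta> k \<in> arcs G" "tail G (\<theta> k) = head G (\<theta> (Suc k))"
  using assms unfolding parameters_def infinite_paths_def reverse_graph_def by auto

lemma shift_in_parameters: "\<theta> \<in> parameters G \<Longrightarrow> shift_map \<theta> \<in> parameters G"
  unfolding parameters_def infinite_paths_def shift_map_def by auto

lemma param_vertex_Suc: "param_vertex G \<theta> (Suc k) = tail G (\<theta> k)"
  unfolding param_vertex_def infinite_path_vertex_def reverse_graph_def by simp

lemma param_vertex_eq_head: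
  "\<theta> \<in> parameters G \<Longrightarrow> param_vertex G \<theta> k = head G (\<theta> k)"
  by (cases k)
     (auto simp: param_vertex_def infinite_path_vertex_def reverse_graph_def parametersD(2))

lemma param_vertex_shift:
  assumes "\<theta> \<in> parameters G"
  shows "param_vertex G (shift_map \<theta>) k = param_vertex G \<theta> (Suc k)"
  using assms shift_in_parameters[OF assms] by (simp add: param_vertex_eq_head shift_map_def)

lemma param_prefix_Suc: "param_prefix \<theta> (Suc k) = param_prefix \<theta> k @ [\<theta> k]"
  unfolding param_prefix_def by simp

lemma param_prefix_shift: "param_prefix \<theta> (Suc k) = \<theta> 0 # param_prefix (shift_map \<theta>) k"
  unfolding param_prefix_def shift_map_def
  by (simp add: upt_conv_Cons map_Suc_upt[symmetric] del: upt_Suc)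

lemma param_map_Suc: "param_map f \<theta> (Suc k) = param_map f \<theta> k \<circ> inv (f (\<theta> k))"
  unfolding param_map_def param_prefix_Suc compose_along_append by simp

lemma param_map_shift: "param_map f \<theta> (Suc k) = inv (f (\<theta> 0)) \<circ> param_map f (shift_map \<theta>) k"
  unfolding param_map_def param_prefix_shift by simp

locale graph_attractor = fin_digraph G
  for G :: "('v, 'e) pre_digraph" +
  fixes f :: "'e \<Rightarrow> 'a::euclidean_space \<Rightarrow> 'a" and A :: "'v \<Rightarrow> 'a set"
  assumes bij_arc_map: "e \<in> arcs G \<Longrightarrow> bij (f e)"
    and attractor: "attractor_components G f A"
begin

lemma compact_component: "i \<in> verts G \<Longrightarrow> compact (A i)"
  and component_nonempty: "i \<in> verts G \<Longrightarrow> A i \<noteq> {}"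
  and component_eq: "i \<in> verts G \<Longrightarrow> A i = (\<Union>e\<in>out_arcs_at G i. f e ` A (head G e))"
  using attractor unfolding attractor_components_def by blast+

lemma out_arcs_nonempty: "i \<in> verts G \<Longrightarrow> out_arcs_at G i \<noteq> {}"
  using component_nonempty component_eq by blast

lemma param_tile_prepend_arc:
  assumes "\<theta> \<in> parameters G" "path_start \<sigma> = param_vertex G \<theta> k"
  shows "param_tile G f A \<theta> (Suc k) (prepend_arc G (\<theta> k) \<sigma>) = param_tile G f A \<theta> k \<sigma>"
proof -
  have "inv (f (\<theta> k)) \<circ> f (\<theta> k) = id"
    using bij_arc_map[OF parametersD(1)[OF assms(1)]] by (simp add: bij_is_inj)
  then have "param_map f \<theta> (Suc k) \<circ> compose_along f (snd (prepend_arc G (\<theta> k) \<sigma>))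
      = param_map f \<theta> k \<circ> compose_along f (snd \<sigma>)"
    unfolding param_map_Suc by (simp add: comp_assoc) (simp flip: comp_assoc)
  moreover have "path_end G (prepend_arc G (\<theta> k) \<sigma>) = path_end G \<sigma>"
    using assms by (intro path_end_prepend_arc) (simp add: path_start_def param_vertex_eq_head)
  ultimately show ?thesis unfolding param_tile_def by simp
qed

lemma param_tile_shift:
  assumes "\<theta> \<in> parameters G"
  shows "f (\<theta> 0) ` param_tile G f A \<theta> (Suc k) \<sigma> = param_tile G f A (shift_map \<theta>) k \<sigma>"
proof -
  have "bij (f (\<theta> 0))" by (intro bij_arc_map parametersD(1)[OF assms])
  then have "f (\<theta> 0) \<circ> inv (f (\<theta> 0)) = id" by (metis bij_is_surj surj_iff)
  then have "f (\<theta> 0) \<circ> (param_map f \<theta> (Suc k) \<circ> compose_along f (snd \<sigma>))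
      = param_map f (shift_map \<theta>) k \<circ> compose_along f (snd \<sigma>)"
    unfolding param_map_shift by (simp add: fun_eq_iff)
  then show ?thesis unfolding param_tile_def by (simp only: image_comp)
qed

lemma param_tile_subdivide:
  assumes "\<sigma> \<in> finite_paths G"
  shows "param_tile G f A \<theta> k \<sigma>
    = (\<Union>e\<in>out_arcs_at G (path_end G \<sigma>). param_tile G f A \<theta> k (append_arc \<sigma> e))"
  unfolding param_tile_def component_eq[OF path_end_in_verts[OF assms]]
  by (simp add: image_UN compose_along_append image_comp comp_assoc)

lemma theta_sequence_patch_mono:
  assumes \<theta>: "\<theta> \<in> parameters G" and S: "theta_sequence G \<theta> S" and "j \<le> k"
  shows "param_tile G f A \<theta> j ` S j \<subseteq> param_tile G f A \<theta> k ` S k"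
proof (rule lift_Suc_mono_le[OF _ \<open>j \<le> k\<close>])
  fix k
  show "param_tile G f A \<theta> k ` S k \<subseteq> param_tile G f A \<theta> (Suc k) ` S (Suc k)"
  proof (rule image_subsetI)
    fix \<sigma> assume \<sigma>: "\<sigma> \<in> S k"
    then have "path_start \<sigma> = param_vertex G \<theta> k"
      using S unfolding theta_sequence_def pre_tree_def by blast
    moreover have "prepend_arc G (\<theta> k) \<sigma> \<in> S (Suc k)"
      using S \<sigma> unfolding theta_sequence_def by blast
    ultimately show "param_tile G f A \<theta> k \<sigma> \<in> param_tile G f A \<theta> (Suc k) ` S (Suc k)"
      using param_tile_prepend_arc[OF \<theta>] by (metis imageI)
  qed
qed

lemma theta_sequence_refine:
  assumes \<theta>: "\<theta> \<in> parameters G" and S: "theta_sequence G \<theta> S"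
  shows "theta_sequence G \<theta> (\<lambda>k. refine_pre_tree (S k))"
proof -
  have "prepend_arc G (\<theta> k) ` refine_pre_tree (S k) \<subseteq> refine_pre_tree (S (Suc k))" for k
  proof (rule image_subsetI)
    fix \<tau> assume "\<tau> \<in> refine_pre_tree (S k)"
    then obtain \<sigma> e where \<sigma>: "\<tau> = append_arc \<sigma> e" "\<sigma> \<in> S k" "e \<in> arcs G" "tail G e = path_end G \<sigma>"
      unfolding refine_pre_tree_def by blast
    have "fst \<sigma> = head G (\<theta> k)"
      using S \<sigma>(2) \<theta> unfolding theta_sequence_def pre_tree_def path_start_def
      by (simp add: param_vertex_eq_head)
    then have "path_end G (prepend_arc G (\<theta> k) \<sigma>) = path_end G \<sigma>" by (rule path_end_prepend_arc)
    moreover have "prepend_arc G (\<theta> k) \<sigma> \<in> S (Suc k)"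
      using S \<sigma> unfolding theta_sequence_def by blast
    moreover have "prepend_arc G (\<theta> k) \<tau> = append_arc (prepend_arc G (\<theta> k) \<sigma>) e"
      unfolding \<sigma>(1) by (simp add: append_arc_def prepend_arc_def)
    ultimately show "prepend_arc G (\<theta> k) \<tau> \<in> refine_pre_tree (S (Suc k))"
      using \<sigma>(3,4) unfolding refine_pre_tree_def by (metis (mono_tags, lifting) mem_Collect_eq)
  qed
  then show ?thesis
    using S pre_tree_refine out_arcs_nonempty unfolding theta_sequence_def by simp
qed

text \<open>
  A sequence \<open>S'\<close> for the shifted parameter becomes a sequence for \<open>\<theta>\<close> when it is preceded by
  one more pre-tree, the branch of \<open>S' 0\<close> along \<open>\<theta> 0\<close>.  This branch is empty if \<open>S' 0\<close> is the trivial path; refining every pre-tree by one level avoids that case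
  and only subdivides tiles.  The tiles for the two parameters then differ by the bijection
  \<open>f (\<theta> 0)\<close>.
\<close>

lemma shift_in_filling_parameters:
  assumes "\<theta> \<in> filling_parameters G f A"
  shows "shift_map \<theta> \<in> filling_parameters G f A"
proof -
  have \<theta>: "\<theta> \<in> parameters G"
    and fill: "\<And>S. theta_sequence G \<theta> S \<Longrightarrow> \<Union>(sequence_tiling G f A \<theta> S) = UNIV"
    using assms unfolding filling_parameters_def by auto
  note \<theta>' = shift_in_parameters[OF \<theta>]
  have "x \<in> \<Union>(sequence_tiling G f A (shift_map \<theta>) S')"
    if S': "theta_sequence G (shift_map \<theta>) S'" for S' x
  proof -
    define R where "R k = refine_pre_tree (S' k)" for k
    define S where "S = case_nat (branch_of_pre_tree (\<theta> 0) (R 0)) R"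
    have R: "theta_sequence G (shift_map \<theta>) R"
      unfolding R_def by (rule theta_sequence_refine[OF \<theta>' S'])
    have R_tree: "pre_tree G (param_vertex G \<theta> (Suc k)) (R k)" for k
      using R param_vertex_shift[OF \<theta>] unfolding theta_sequence_def by metis
    have "pre_tree G (head G (\<theta> 0)) (branch_of_pre_tree (\<theta> 0) (R 0))"
    proof (rule pre_tree_branch[OF R_tree])
      show "\<theta> 0 \<in> arcs G" using parametersD(1)[OF \<theta>] .
      show "tail G (\<theta> 0) = param_vertex G \<theta> (Suc 0)" by (simp add: param_vertex_Suc)
      show "(param_vertex G \<theta> (Suc 0), []) \<notin> R 0"
        unfolding R_def refine_pre_tree_def append_arc_def by auto
    qed
    then have "pre_tree G (param_vertex G \<theta> k) (S k)" for k
      using R_tree unfolding S_def by (cases k) (simp_all add: param_vertex_eq_head[OF \<theta>])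
    moreover have "prepend_arc G (\<theta> k) ` S k \<subseteq> S (Suc k)" for k
      using R unfolding S_def theta_sequence_def
      by (cases k) (auto simp: branch_of_pre_tree_def shift_map_def)
    ultimately have S: "theta_sequence G \<theta> S" unfolding theta_sequence_def by blast
    obtain y where y: "x = f (\<theta> 0) y"
      using bij_arc_map[OF parametersD(1)[OF \<theta>]] by (metis bij_pointE)
    have "y \<in> \<Union>(sequence_tiling G f A \<theta> S)" using fill[OF S] by simp
    then obtain k where "y \<in> \<Union>(param_tile G f A \<theta> k ` S k)"
      unfolding sequence_tiling_def by blast
    then have "y \<in> \<Union>(param_tile G f A \<theta> (Suc k) ` S (Suc k))"
      using theta_sequence_patch_mono[OF \<theta> S, of k "Suc k"] by (meson Union_mono le_SucI order_refl subsetD)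
    then obtain \<sigma> where \<sigma>: "\<sigma> \<in> R k" "y \<in> param_tile G f A \<theta> (Suc k) \<sigma>"
      unfolding S_def by auto
    then have "x \<in> param_tile G f A (shift_map \<theta>) k \<sigma>"
      using param_tile_shift[OF \<theta>] y by blast
    moreover obtain \<sigma>' e where "\<sigma> = append_arc \<sigma>' e" "\<sigma>' \<in> S' k" "e \<in> out_arcs_at G (path_end G \<sigma>')"
      using \<sigma>(1) unfolding R_def refine_pre_tree_def out_arcs_at_def by blast
    moreover have "\<sigma>' \<in> finite_paths G"
      using S' \<open>\<sigma>' \<in> S' k\<close> unfolding theta_sequence_def pre_tree_def by blast
    ultimately have "x \<in> param_tile G f A (shift_map \<theta>) k \<sigma>'"
      using param_tile_subdivide[of \<sigma>' "shift_map \<theta>" k] by blast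
    then show ?thesis
      using \<open>\<sigma>' \<in> S' k\<close> unfolding sequence_tiling_def by blast
  qed
  then show ?thesis unfolding filling_parameters_def using \<theta>' by blast
qed

end


section \<open>Cutting the path tree at a given weight\<close>

lemma path_weight_simps [simp]:
  "path_weight wt [] = 0"
  "path_weight wt (e # p) = int (wt e) + path_weight wt p"
  "path_weight wt (p @ q) = path_weight wt p + path_weight wt q"
  unfolding path_weight_def by simp_all

lemma path_weight_nonneg: "0 \<le> path_weight wt p"
  by (induction p) auto

locale weighted_attractor = graph_attractor G f A
  for G :: "('v, 'e) pre_digraph" and f :: "'e \<Rightarrow> 'a::euclidean_space \<Rightarrow> 'a" and A +
  fixes wt :: "'e \<Rightarrow> nat"
  assumes wt_pos: "e \<in> arcs G \<Longrightarrow> 0 < wt e"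
begin

lemma length_le_path_weight: "set p \<subseteq> arcs G \<Longrightarrow> int (length p) \<le> path_weight wt p"
  using wt_pos by (induction p) (auto simp: Suc_le_eq, force)

lemma wt_le_total: "e \<in> arcs G \<Longrightarrow> wt e \<le> sum wt (arcs G)"
  by (rule member_le_sum) auto

definition weight_cut :: "'v \<Rightarrow> int \<Rightarrow> ('v, 'e) gpath set" where
  "weight_cut r N = {\<sigma> \<in> finite_paths G. snd \<sigma> \<noteq> [] \<and> path_start \<sigma> = r \<and>
     0 < path_weight wt (snd \<sigma>) - N \<and>
     path_weight wt (snd \<sigma>) - N \<le> int (wt (last (snd \<sigma>)))}"

lemma balanced_sequence_eq_weight_cut:
  "balanced_sequence G wt \<theta> k
    = weight_cut (param_vertex G \<theta> k) (path_weight wt (param_prefix \<theta> k))"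
  unfolding balanced_sequence_def weight_cut_def by simp

text \<open>
  A path of weight at most \<open>N\<close> can be prolonged, starting with any prescribed arc, until its
  weight exceeds \<open>N\<close> for the first time; the path reached then lies in the cut.
\<close>

lemma extend_to_weight_cut:
  assumes "\<sigma> \<in> finite_paths G" "e \<in> arcs G" "tail G e = path_end G \<sigma>"
    and "path_weight wt (snd \<sigma>) \<le> N"
  shows "\<exists>\<sigma>'\<in>weight_cut (fst \<sigma>) N. subpath_of (append_arc \<sigma> e) \<sigma>'"
  using assms
proof (induction "nat (N - path_weight wt (snd \<sigma>))" arbitrary: \<sigma> e rule: less_induct)
  case less
  define \<tau> where "\<tau> = append_arc \<sigma> e"
  have \<tau>: "\<tau> \<in> finite_paths G" "path_end G \<tau> = head G e" "fst \<tau> = fst \<sigma>"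
    unfolding \<tau>_def using less.prems by (simp_all add: append_arc_in_finite_paths)
  have weight: "path_weight wt (snd \<tau>) = path_weight wt (snd \<sigma>) + int (wt e)"
    unfolding \<tau>_def by simp
  show ?case
  proof (cases "path_weight wt (snd \<tau>) \<le> N")
    case False
    then have "\<tau> \<in> weight_cut (fst \<sigma>) N"
      unfolding weight_cut_def path_start_def using \<tau> weight less.prems by (simp add: \<tau>_def)
    then show ?thesis by (intro bexI[of _ \<tau>]) (auto simp: subpath_of_def \<tau>_def)
  next
    case True
    have "head G e \<in> verts G" using less.prems by simp
    then obtain e' where e': "e' \<in> arcs G" "tail G e' = path_end G \<tau>"
      using out_arcs_nonempty \<tau> unfolding out_arcs_at_def by fastforce
    have "nat (N - path_weight wt (snd \<tau>)) < nat (N - path_weight wt (snd \<sigma>))"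
      using weight wt_pos[OF less.prems(2)] True by simp
    from less.hyps[OF this \<tau>(1) e' True]
    obtain \<sigma>' where "\<sigma>' \<in> weight_cut (fst \<sigma>) N" "subpath_of (append_arc \<tau> e') \<sigma>'"
      using \<tau>(3) by auto
    then show ?thesis
      by (intro bexI[of _ \<sigma>']) (auto simp: subpath_of_def \<tau>_def prefix_def)
  qed
qed

lemma pre_tree_weight_cut:
  assumes r: "r \<in> verts G" and N: "N \<ge> 0"
  shows "pre_tree G r (weight_cut r N)"
proof -
  have below: "path_weight wt (snd \<tau>) \<le> N"
    if "\<sigma> \<in> weight_cut r N" "proper_subpath \<tau> \<sigma>" for \<sigma> \<tau>
  proof -
    have "strict_prefix (snd \<tau>) (snd \<sigma>)" using that(2) unfolding proper_subpath_def by blast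
    moreover have "snd \<sigma> = butlast (snd \<sigma>) @ [last (snd \<sigma>)]"
      using that(1) unfolding weight_cut_def by simp
    ultimately have "prefix (snd \<tau>) (butlast (snd \<sigma>))"
      by (metis prefix_snoc strict_prefix_def)
    then obtain q where "butlast (snd \<sigma>) = snd \<tau> @ q" by (auto simp: prefix_def)
    then have "path_weight wt (snd \<tau>) \<le> path_weight wt (butlast (snd \<sigma>))"
      using path_weight_nonneg[of wt q] by simp
    also have "\<dots> = path_weight wt (snd \<sigma>) - int (wt (last (snd \<sigma>)))"
      by (subst (2) \<open>snd \<sigma> = _\<close>) simp
    also have "\<dots> \<le> N" using that(1) unfolding weight_cut_def by simp
    finally show ?thesis .
  qed
  have "weight_cut r N \<subseteq> {r} \<times> {p. set p \<subseteq> arcs G \<and> length p \<le> nat N + sum wt (arcs G)}"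
  proof
    fix \<sigma> assume \<sigma>: "\<sigma> \<in> weight_cut r N"
    then have arcs: "set (snd \<sigma>) \<subseteq> arcs G" "snd \<sigma> \<noteq> []"
      unfolding weight_cut_def finite_paths_iff by auto
    have "int (length (snd \<sigma>)) \<le> path_weight wt (snd \<sigma>)"
      using arcs by (intro length_le_path_weight)
    also have "\<dots> \<le> N + int (wt (last (snd \<sigma>)))"
      using \<sigma> unfolding weight_cut_def by auto
    also have "\<dots> \<le> N + int (sum wt (arcs G))"
      using wt_le_total[of "last (snd \<sigma>)"] arcs by (simp del: of_nat_sum) (meson last_in_set subsetD)
    finally have "length (snd \<sigma>) \<le> nat N + sum wt (arcs G)" using N by linarith
    then show "\<sigma> \<in> {r} \<times> {p. set p \<subseteq> arcs G \<and> length p \<le> nat N + sum wt (arcs G)}"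
      using arcs \<sigma> unfolding weight_cut_def path_start_def by (cases \<sigma>) auto
  qed
  moreover have "finite ({r} \<times> {p. set p \<subseteq> arcs G \<and> length p \<le> nat N + sum wt (arcs G)})"
    by (intro finite_cartesian_product finite_lists_length_le) auto
  ultimately have fin: "finite (weight_cut r N)" by (rule finite_subset)
  have trivial: "(r, []) \<in> finite_paths G" "path_end G (r, []) = r"
    using r by (auto simp: finite_paths_iff path_end_def awalk_Nil_iff)
  obtain e where "e \<in> arcs G" "tail G e = r"
    using out_arcs_nonempty[OF r] unfolding out_arcs_at_def by blast
  then have ne: "weight_cut r N \<noteq> {}"
    using extend_to_weight_cut[OF trivial(1), of e N] trivial(2) N by auto
  have antichain: "\<tau> \<notin> weight_cut r N"
    if "\<sigma> \<in> weight_cut r N" "proper_subpath \<tau> \<sigma>" for \<sigma> \<tau>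
    using below[OF that] unfolding weight_cut_def by auto
  have complete: "\<exists>\<sigma>'\<in>weight_cut r N. subpath_of (append_arc \<tau> e) \<sigma>'"
    if "\<sigma> \<in> weight_cut r N" "e \<in> arcs G" "proper_subpath \<tau> \<sigma>" "tail G e = path_end G \<tau>"
    for \<sigma> \<tau> e
  proof -
    have \<tau>: "fst \<tau> = fst \<sigma>" "prefix (snd \<tau>) (snd \<sigma>)"
      using that(3) unfolding proper_subpath_def by auto
    moreover have "awalk (fst \<sigma>) (snd \<sigma>) (path_end G \<sigma>)" "fst \<sigma> = r"
      using that(1) unfolding weight_cut_def finite_paths_iff path_start_def by auto
    ultimately have "\<tau> \<in> finite_paths G" "fst \<tau> = r"
      unfolding finite_paths_iff path_end_def by (auto simp: prefix_def)
    then show ?thesis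
      using extend_to_weight_cut[OF _ that(2,4) below[OF that(1,3)]] by simp
  qed
  have "weight_cut r N \<subseteq> finite_paths G" "\<forall>\<sigma>\<in>weight_cut r N. path_start \<sigma> = r"
    unfolding weight_cut_def by auto
  then show ?thesis
    unfolding pre_tree_def using fin ne antichain complete by blast
qed


section \<open>Balanced tilings and the shift\<close>

lemma theta_sequence_balanced:
  assumes \<theta>: "\<theta> \<in> parameters G"
  shows "theta_sequence G \<theta> (balanced_sequence G wt \<theta>)"
  unfolding theta_sequence_def
proof (intro conjI allI)
  fix k
  show "pre_tree G (param_vertex G \<theta> k) (balanced_sequence G wt \<theta> k)"
    unfolding balanced_sequence_eq_weight_cut
    using parametersD(1)[OF \<theta>]
    by (intro pre_tree_weight_cut path_weight_nonneg) (simp add: param_vertex_eq_head[OF \<theta>])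
  show "prepend_arc G (\<theta> k) ` balanced_sequence G wt \<theta> k \<subseteq> balanced_sequence G wt \<theta> (Suc k)"
    unfolding balanced_sequence_def param_prefix_Suc
    using prepend_arc_in_finite_paths parametersD(1)[OF \<theta>]
    by (auto simp: path_start_def param_vertex_eq_head[OF \<theta>] param_vertex_Suc)
qed

lemma balanced_tiling_covers:
  assumes "\<theta> \<in> filling_parameters G f A"
  shows "\<Union>(balanced_tiling G f A wt \<theta>) = UNIV"
  using assms theta_sequence_balanced
  unfolding filling_parameters_def balanced_tiling_def by blast

text \<open>
  The index \<open>0\<close> contributes nothing to the level-one tiling: the weight of a path plus the
  positive number \<open>wt (\<theta> 0)\<close> exceeds the weight of its last arc.  From index \<open>1\<close> on, the
  defining condition is the balance condition for the shifted parameter, whose prefixes have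
  lost exactly the weight \<open>wt (\<theta> 0)\<close>.
\<close>

lemma level_one_tiling_eq:
  assumes \<theta>: "\<theta> \<in> parameters G"
  shows "level_one_tiling G f A wt \<theta>
    = (\<Union>k. param_tile G f A \<theta> (Suc k) ` balanced_sequence G wt (shift_map \<theta>) k)"
proof -
  define P where "P k \<sigma> \<longleftrightarrow> \<sigma> \<in> finite_paths G \<and> snd \<sigma> \<noteq> [] \<and>
      path_start \<sigma> = param_vertex G \<theta> k \<and>
      0 < path_weight wt (snd \<sigma>) - path_weight wt (param_prefix \<theta> k) + int (wt (\<theta> 0)) \<and>
      path_weight wt (snd \<sigma>) - path_weight wt (param_prefix \<theta> k) + int (wt (\<theta> 0))
        \<le> int (wt (last (snd \<sigma>)))" for k \<sigma>
  have zero: "\<not> P 0 \<sigma>" for \<sigma>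
  proof
    assume P: "P 0 \<sigma>"
    then obtain q a where "snd \<sigma> = q @ [a]" unfolding P_def by (meson rev_exhaust)
    then show False
      using P path_weight_nonneg[of wt q] wt_pos[OF parametersD(1)[OF \<theta>, of 0]]
      unfolding P_def by (simp add: param_prefix_def)
  qed
  have Suc: "P (Suc k) \<sigma> \<longleftrightarrow> \<sigma> \<in> balanced_sequence G wt (shift_map \<theta>) k" for k \<sigma>
    unfolding P_def balanced_sequence_def param_vertex_shift[OF \<theta>] param_prefix_shift
    by auto
  have "level_one_tiling G f A wt \<theta> = {param_tile G f A \<theta> k \<sigma> | k \<sigma>. P k \<sigma>}"
    unfolding level_one_tiling_def P_def by simp
  also have "\<dots> = {param_tile G f A \<theta> (Suc k) \<sigma> | k \<sigma>. P (Suc k) \<sigma>}"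
    using zero by (metis (no_types, lifting) not0_implies_Suc)
  finally show ?thesis unfolding Suc by blast
qed

lemma balanced_tiling_shift:
  assumes \<theta>: "\<theta> \<in> parameters G"
  shows "balanced_tiling G f A wt (shift_map \<theta>)
    = (\<lambda>t. f (\<theta> 0) ` t) ` level_one_tiling G f A wt \<theta>"
  unfolding level_one_tiling_eq[OF \<theta>] balanced_tiling_def sequence_tiling_def
  by (simp add: image_UN image_image param_tile_shift[OF \<theta>])

end


section \<open>Similarities\<close>

lemma similarity_comp:
  assumes "similarity_with_ratio a g" "similarity_with_ratio b h"
  shows "similarity_with_ratio (a * b) (g \<circ> h)"
  using assms unfolding similarity_with_ratio_def by simp

lemma similarity_inv:
  assumes "bij g" "r > 0" "similarity_with_ratio r g"
  shows "similarity_with_ratio (inverse r) (inv g)"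
  unfolding similarity_with_ratio_def
proof (intro allI)
  fix x y
  have "dist x y = r * dist (inv g x) (inv g y)"
    using assms by (metis similarity_with_ratio_def bij_inv_eq_iff)
  then show "dist (inv g x) (inv g y) = inverse r * dist x y"
    using \<open>r > 0\<close> by (simp add: field_simps)
qed

lemma similarity_continuous_on:
  assumes "similarity_with_ratio r g"
  shows "continuous_on S g"
proof (rule lipschitz_on_continuous_on)
  show "\<bar>r\<bar>-lipschitz_on S g"
    using assms unfolding similarity_with_ratio_def
    by (intro lipschitz_onI) (auto intro: mult_right_mono)
qed

lemma similarity_image_ball:
  assumes "bij g" "r > 0" "similarity_with_ratio r g"
  shows "g ` ball x \<rho> = ball (g x) (r * \<rho>)"
proof (intro set_eqI iffI)
  fix y assume "y \<in> g ` ball x \<rho>"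
  then show "y \<in> ball (g x) (r * \<rho>)"
    using assms(2,3) unfolding similarity_with_ratio_def by auto
next
  fix y assume y: "y \<in> ball (g x) (r * \<rho>)"
  obtain z where z: "y = g z" using assms(1) by (metis bij_pointE)
  then show "y \<in> g ` ball x \<rho>"
    using y assms(2,3) unfolding similarity_with_ratio_def by auto
qed

lemma similarity_image_interior_empty:
  fixes g :: "'a::metric_space \<Rightarrow> 'a"
  assumes g: "bij g" "r > 0" "similarity_with_ratio r g" and X: "interior X = {}"
  shows "interior (g ` X) = {}"
proof (rule ccontr)
  assume "interior (g ` X) \<noteq> {}"
  then obtain y \<rho> where y: "\<rho> > 0" "ball y \<rho> \<subseteq> g ` X"
    using mem_interior by blast
  obtain x where x: "y = g x" using g(1) by (metis bij_pointE)
  have "g ` ball x (\<rho> / r) = ball y \<rho>"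
    using similarity_image_ball[OF g] x g(2) by simp
  then have "ball x (\<rho> / r) \<subseteq> X"
    using y(2) g(1) by (metis bij_is_inj inj_image_subset_iff)
  then show False using X y(1) g(2) mem_interior by (metis divide_pos_pos empty_iff)
qed

lemma compose_along_similarity:
  assumes "s > 0"
    and "\<And>e. e \<in> set p \<Longrightarrow> bij (h e) \<and> similarity_with_ratio (s powi w e) (h e)"
  shows "bij (compose_along h p)
    \<and> similarity_with_ratio (s powi (\<Sum>e\<leftarrow>p. w e)) (compose_along h p)"
  using assms(2)
proof (induction p)
  case Nil
  show ?case using bij_id by (simp add: similarity_with_ratio_def id_def)
next
  case (Cons e p)
  let ?r = "\<Sum>e\<leftarrow>p. w e"
  have p: "bij (compose_along h p)" "similarity_with_ratio (s powi ?r) (compose_along h p)"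
    and e: "bij (h e)" "similarity_with_ratio (s powi w e) (h e)"
    using Cons by auto
  have "s powi (\<Sum>e\<leftarrow>e # p. w e) = s powi w e * s powi ?r"
    using assms(1) by (simp add: power_int_add)
  then show ?case
    using bij_comp[OF p(1) e(1)] similarity_comp[OF e(2) p(2)]
    by (simp only: compose_along_simps simp_thms)
qed


section \<open>Families of fat sets with disjoint interiors\<close>

text \<open>
  A packing argument: each set contains a ball of radius \<open>\<rho>\<close>, and the centres of these balls
  are at mutual distance at least \<open>\<rho>\<close>, so only finitely many of them fit into a bounded region.
\<close>

lemma finite_fat_sets_meeting_ball:
  fixes T :: "'a::euclidean_space set set"
  assumes "\<rho> > 0"
    and fat: "\<And>t. t \<in> T \<Longrightarrow> \<exists>c. ball c \<rho> \<subseteq> t"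
    and diam: "\<And>t x y. t \<in> T \<Longrightarrow> x \<in> t \<Longrightarrow> y \<in> t \<Longrightarrow> dist x y \<le> D"
    and disjoint: "\<And>t t'. t \<in> T \<Longrightarrow> t' \<in> T \<Longrightarrow> t \<noteq> t' \<Longrightarrow> interior (t \<inter> t') = {}"
  shows "finite {t \<in> T. t \<inter> cball 0 R \<noteq> {}}"
proof -
  obtain c where c: "\<And>t. t \<in> T \<Longrightarrow> ball (c t) \<rho> \<subseteq> t" using fat by metis
  define F where "F = {t \<in> T. t \<inter> cball 0 R \<noteq> {}}"
  have c_in: "c t \<in> ball (c t) \<rho>" for t using \<open>\<rho> > 0\<close> by simp
  have apart: "dist (c t) (c t') \<ge> \<rho>" if "t \<in> T" "t' \<in> T" "t \<noteq> t'" for t t'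
  proof (rule ccontr)
    assume "\<not> ?thesis"
    then have "c t' \<in> ball (c t) \<rho> \<inter> ball (c t') \<rho>" using \<open>\<rho> > 0\<close> by simp
    moreover have "ball (c t) \<rho> \<inter> ball (c t') \<rho> \<subseteq> interior (t \<inter> t')"
      using c that by (intro interior_maximal) auto
    ultimately show False using disjoint[OF that] by blast
  qed
  have inj: "inj_on c F"
    using apart \<open>\<rho> > 0\<close> unfolding F_def inj_on_def by force
  have "c ` F \<subseteq> cball 0 (R + D)"
  proof (rule image_subsetI)
    fix t assume "t \<in> F"
    then obtain x where x: "t \<in> T" "x \<in> t" "norm x \<le> R" unfolding F_def by auto
    have "dist (c t) x \<le> D" using diam[OF x(1) _ x(2)] c[OF x(1)] c_in by blast
    then show "c t \<in> cball 0 (R + D)"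
      using norm_triangle_ineq2[of "c t" x] x(3) by (simp add: dist_norm)
  qed
  then have "bounded (c ` F)" by (meson bounded_cball bounded_subset)
  have "finite (c ` F)"
  proof (rule ccontr)
    assume "infinite (c ` F)"
    then obtain x where "x islimpt c ` F"
      using bounded_infinite_imp_islimpt[OF order_refl \<open>bounded (c ` F)\<close>] by blast
    then have inf: "infinite (c ` F \<inter> ball x (\<rho>/2))"
      using \<open>\<rho> > 0\<close> unfolding islimpt_eq_infinite_ball by simp
    then obtain y where y: "y \<in> c ` F \<inter> ball x (\<rho>/2)"
      using infinite_imp_nonempty by blast
    have "infinite (c ` F \<inter> ball x (\<rho>/2) - {y})" using inf by simp
    then obtain z where z: "z \<in> c ` F \<inter> ball x (\<rho>/2)" "z \<noteq> y"
      using infinite_imp_nonempty by blast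
    then obtain t t' where "t \<in> F" "t' \<in> F" "y = c t" "z = c t'" using y by blast
    then have "dist y z \<ge> \<rho>" using apart z(2) unfolding F_def by blast
    moreover have "dist y z < \<rho>"
      using y z dist_triangle_half_l[of y x \<rho> z] by (simp add: dist_commute)
    ultimately show False by simp
  qed
  then show ?thesis using inj finite_imageD unfolding F_def by blast
qed

lemma interior_finite_Union_empty:
  assumes "finite F" "\<And>X. X \<in> F \<Longrightarrow> closed X \<and> interior X = {}"
  shows "interior (\<Union>F) = {}"
  using assms by (induction F) (auto simp: interior_closed_Un_empty_interior)

text \<open>
  In the interior of the covered ball, \<open>t\<close> is a finite union of closed sets with empty interior,
  so no ball contained in \<open>t\<close> meets it.  In particular \<open>norm c \<ge> R\<close>, and \<open>t\<close> reaches at most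
  \<open>D\<close> closer to the origin than \<open>c\<close>.
\<close>

lemma fat_set_outside_covered_ball:
  fixes t :: "'a::euclidean_space set"
  assumes "\<rho> > 0" "ball c \<rho> \<subseteq> t" and t: "closed t"
    and diam: "\<And>x y. x \<in> t \<Longrightarrow> y \<in> t \<Longrightarrow> dist x y \<le> D"
    and P: "finite P" "cball 0 R \<subseteq> \<Union>P"
    and P_closed: "\<And>t'. t' \<in> P \<Longrightarrow> closed t'"
    and disjoint: "\<And>t'. t' \<in> P \<Longrightarrow> interior (t \<inter> t') = {}"
    and x: "x \<in> t"
  shows "norm x \<ge> R - D"
proof -
  have "interior (\<Union>((\<inter>) t ` P)) = {}"
    using P(1) t P_closed disjoint by (intro interior_finite_Union_empty) auto
  moreover have "ball c \<rho> \<inter> ball 0 R \<subseteq> interior (\<Union>((\<inter>) t ` P))"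
  proof (rule interior_maximal)
    show "ball c \<rho> \<inter> ball 0 R \<subseteq> \<Union>((\<inter>) t ` P)"
    proof
      fix y assume y: "y \<in> ball c \<rho> \<inter> ball 0 R"
      then have "y \<in> cball 0 R" by simp
      with P(2) have "y \<in> \<Union>P" by blast
      moreover have "y \<in> t" using y assms(2) by blast
      ultimately show "y \<in> \<Union>((\<inter>) t ` P)" by blast
    qed
  qed auto
  ultimately have "c \<notin> ball c \<rho> \<inter> ball 0 R" by blast
  then have "norm c \<ge> R" using \<open>\<rho> > 0\<close> by simp
  moreover have "c \<in> t" using assms(1,2) by auto
  then have "norm (c - x) \<le> D" using diam[OF _ x] by (simp add: dist_norm)
  ultimately show ?thesis using norm_triangle_ineq2[of c x] by simp
qed

lemma uniform_positive_witness:
  assumes "finite V" "\<And>i. i \<in> V \<Longrightarrow> \<exists>r>0. Q i (r::real)"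
    and mono: "\<And>i r r'. Q i r \<Longrightarrow> r' \<le> r \<Longrightarrow> Q i r'"
  obtains r where "r > 0" "\<And>i. i \<in> V \<Longrightarrow> Q i r"
proof -
  obtain r where r: "\<And>i. i \<in> V \<Longrightarrow> r i > 0 \<and> Q i (r i)" using assms(2) by metis
  define m where "m = Min (insert 1 (r ` V))"
  have "m > 0" unfolding m_def using assms(1) r by (subst Min_gr_iff) auto
  moreover have "m \<le> r i" if "i \<in> V" for i
    unfolding m_def using assms(1) that by (intro Min_le) auto
  ultimately show ?thesis using that r mono by meson
qed


section \<open>Similarity systems\<close>

locale similarity_attractor = weighted_attractor G f A wt
  for G :: "('v, 'e) pre_digraph" and f :: "'e \<Rightarrow> 'a::euclidean_space \<Rightarrow> 'a" and A wt +
  fixes s :: real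
  assumes interior_component: "i \<in> verts G \<Longrightarrow> interior (A i) \<noteq> {}"
    and overlap: "\<lbrakk>e \<in> arcs G; e' \<in> arcs G; tail G e = tail G e'; e \<noteq> e'\<rbrakk> \<Longrightarrow>
      interior (f e ` A (head G e) \<inter> f e' ` A (head G e')) = {}"
    and s_pos: "s > 0"
    and similarity: "e \<in> arcs G \<Longrightarrow> similarity_with_ratio (s ^ wt e) (f e)"
begin

lemma compose_along_path:
  assumes "set p \<subseteq> arcs G"
  shows "bij (compose_along f p)"
    and "similarity_with_ratio (s powi path_weight wt p) (compose_along f p)"
  using compose_along_similarity[OF s_pos, of p f "\<lambda>e. int (wt e)"] assms bij_arc_map similarity
  unfolding path_weight_def by auto

lemma param_map_similarity:
  assumes \<theta>: "\<theta> \<in> parameters G"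
  shows "bij (param_map f \<theta> k)"
    and "similarity_with_ratio (s powi (- path_weight wt (param_prefix \<theta> k))) (param_map f \<theta> k)"
proof -
  have "bij (inv (f e)) \<and> similarity_with_ratio (s powi (- int (wt e))) (inv (f e))"
    if "e \<in> set (param_prefix \<theta> k)" for e
  proof -
    have "e \<in> arcs G" using that parametersD(1)[OF \<theta>] unfolding param_prefix_def by auto
    then show ?thesis
      using similarity_inv[OF bij_arc_map _ similarity] s_pos bij_arc_map
      by (simp add: bij_imp_bij_inv power_int_minus)
  qed
  from compose_along_similarity[OF s_pos,
      where h = "\<lambda>e. inv (f e)" and p = "param_prefix \<theta> k" and w = "\<lambda>e. - int (wt e)", OF this]
  show "bij (param_map f \<theta> k)"
    and "similarity_with_ratio (s powi (- path_weight wt (param_prefix \<theta> k))) (param_map f \<theta> k)"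
    unfolding param_map_def path_weight_def
    by (simp_all add: uminus_sum_list_map comp_def)
qed

lemma tile_map_similarity:
  assumes \<theta>: "\<theta> \<in> parameters G" and p: "set p \<subseteq> arcs G"
  shows "bij (param_map f \<theta> k \<circ> compose_along f p)"
    and "similarity_with_ratio
      (s powi (path_weight wt p - path_weight wt (param_prefix \<theta> k)))
      (param_map f \<theta> k \<circ> compose_along f p)"
proof -
  show "bij (param_map f \<theta> k \<circ> compose_along f p)"
    using bij_comp compose_along_path(1)[OF p] param_map_similarity(1)[OF \<theta>] by blast
  have "s powi (- path_weight wt (param_prefix \<theta> k)) * s powi path_weight wt p
      = s powi (path_weight wt p - path_weight wt (param_prefix \<theta> k))"
    using s_pos by (simp flip: power_int_add)
  then show "similarity_with_ratio
      (s powi (path_weight wt p - path_weight wt (param_prefix \<theta> k)))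
      (param_map f \<theta> k \<circ> compose_along f p)"
    using similarity_comp[OF param_map_similarity(2)[OF \<theta>, of k] compose_along_path(2)[OF p]]
    by metis
qed

lemma compose_along_image_subset:
  assumes "awalk u p v"
  shows "compose_along f p ` A v \<subseteq> A u"
  using assms
proof (induction p arbitrary: u)
  case Nil
  then show ?case by (simp add: awalk_Nil_iff)
next
  case (Cons e p)
  then have "e \<in> arcs G" "tail G e = u" "compose_along f p ` A v \<subseteq> A (head G e)"
    by (auto simp: awalk_Cons_iff)
  moreover have "u \<in> verts G" using Cons.prems by auto
  ultimately show ?case
    using component_eq[of u] unfolding out_arcs_at_def
    by (auto simp flip: image_image simp: image_comp[symmetric])
qed

lemma param_tile_compact:
  assumes "\<theta> \<in> parameters G" "\<sigma> \<in> finite_paths G"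
  shows "compact (param_tile G f A \<theta> k \<sigma>)" "param_tile G f A \<theta> k \<sigma> \<noteq> {}"
proof -
  have \<sigma>: "set (snd \<sigma>) \<subseteq> arcs G" "path_end G \<sigma> \<in> verts G"
    using assms(2) by (auto simp: finite_paths_iff)
  show "compact (param_tile G f A \<theta> k \<sigma>)"
    unfolding param_tile_def
    using similarity_continuous_on[OF tile_map_similarity(2)[OF assms(1) \<sigma>(1)]]
      compact_component[OF \<sigma>(2)] by (intro compact_continuous_image)
  show "param_tile G f A \<theta> k \<sigma> \<noteq> {}"
    unfolding param_tile_def using component_nonempty[OF \<sigma>(2)] by simp
qed

text \<open>
  Two paths of a pre-tree separate after a common initial segment, at two different arcs with
  the same tail.  Their tiles lie in the images of the two pieces belonging to these arcs, under
  one and the same similarity.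
\<close>

lemma pre_tree_tiles_disjoint_interior:
  assumes \<theta>: "\<theta> \<in> parameters G" and S: "pre_tree G r S"
    and \<sigma>: "\<sigma> \<in> S" "\<sigma>' \<in> S" "\<sigma> \<noteq> \<sigma>'"
  shows "interior (param_tile G f A \<theta> k \<sigma> \<inter> param_tile G f A \<theta> k \<sigma>') = {}"
proof -
  have roots: "fst \<sigma> = r" "fst \<sigma>' = r"
    using S \<sigma> unfolding pre_tree_def path_start_def by auto
  have "\<not> proper_subpath \<sigma> \<sigma>'" "\<not> proper_subpath \<sigma>' \<sigma>"
    using S \<sigma> unfolding pre_tree_def by blast+
  moreover have "snd \<sigma> \<noteq> snd \<sigma>'" using roots \<sigma>(3) by (simp add: prod_eq_iff)
  ultimately have "snd \<sigma> \<parallel> snd \<sigma>'"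
    using roots unfolding proper_subpath_def parallel_def strict_prefix_def by auto
  then obtain p b q c q' where split: "b \<noteq> c" "snd \<sigma> = p @ b # q" "snd \<sigma>' = p @ c # q'"
    using parallel_decomp by blast
  define g where "g = param_map f \<theta> k \<circ> compose_along f p"
  have tile_subset: "param_tile G f A \<theta> k \<tau> \<subseteq> g ` (f a ` A (head G a))
      \<and> set p \<subseteq> arcs G \<and> a \<in> arcs G \<and> tail G a = awlast r p"
    if \<tau>: "\<tau> \<in> S" "snd \<tau> = p @ a # q" for \<tau> a q
  proof -
    have "fst \<tau> = r" "\<tau> \<in> finite_paths G"
      using S \<tau>(1) unfolding pre_tree_def path_start_def by auto
    then have "awalk r (p @ a # q) (path_end G \<tau>)"
      using \<tau>(2) by (simp add: finite_paths_iff)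
    then have w: "awalk r p (awlast r p)" "a \<in> arcs G" "tail G a = awlast r p"
      "awalk (head G a) q (path_end G \<tau>)"
      by (auto simp: awalk_Cons_iff)
    have "compose_along f q ` A (path_end G \<tau>) \<subseteq> A (head G a)"
      by (rule compose_along_image_subset[OF w(4)])
    moreover have "param_tile G f A \<theta> k \<tau> = g ` (f a ` (compose_along f q ` A (path_end G \<tau>)))"
      unfolding param_tile_def \<tau>(2) g_def compose_along_append by (simp add: image_comp comp_assoc)
    ultimately show ?thesis using w by auto
  qed
  note b = tile_subset[OF \<sigma>(1) split(2)] and c = tile_subset[OF \<sigma>(2) split(3)]
  have g: "bij g" "similarity_with_ratio
      (s powi (path_weight wt p - path_weight wt (param_prefix \<theta> k))) g"
    unfolding g_def using tile_map_similarity[OF \<theta>] b by blast+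
  have "param_tile G f A \<theta> k \<sigma> \<inter> param_tile G f A \<theta> k \<sigma>'
      \<subseteq> g ` (f b ` A (head G b) \<inter> f c ` A (head G c))"
    using b c image_Int[OF bij_is_inj[OF g(1)]] by blast
  moreover have "interior (g ` (f b ` A (head G b) \<inter> f c ` A (head G c))) = {}"
    using b c split(1) s_pos
    by (intro similarity_image_interior_empty[OF g(1) _ g(2)] overlap) auto
  ultimately show ?thesis by (metis interior_mono subset_empty)
qed

lemma theta_sequence_tiles_disjoint_interior:
  assumes \<theta>: "\<theta> \<in> parameters G" and S: "theta_sequence G \<theta> S"
    and t: "t \<in> sequence_tiling G f A \<theta> S" "t' \<in> sequence_tiling G f A \<theta> S" "t \<noteq> t'"
  shows "interior (t \<inter> t') = {}"
proof -
  obtain j j' where "t \<in> param_tile G f A \<theta> j ` S j" "t' \<in> param_tile G f A \<theta> j' ` S j'"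
    using t unfolding sequence_tiling_def by blast
  then have "t \<in> param_tile G f A \<theta> (max j j') ` S (max j j')"
    and "t' \<in> param_tile G f A \<theta> (max j j') ` S (max j j')"
    using theta_sequence_patch_mono[OF \<theta> S] by (meson max.cobounded1 max.cobounded2 subsetD)+
  then obtain \<sigma> \<sigma>' where "\<sigma> \<in> S (max j j')" "\<sigma>' \<in> S (max j j')"
    and "t = param_tile G f A \<theta> (max j j') \<sigma>" "t' = param_tile G f A \<theta> (max j j') \<sigma>'"
    by blast
  moreover have "pre_tree G (param_vertex G \<theta> (max j j')) (S (max j j'))"
    using S unfolding theta_sequence_def by blast
  ultimately show ?thesis
    using pre_tree_tiles_disjoint_interior[OF \<theta>] t(3) by blast
qed

text \<open>
  A balanced tile is the image of some \<open>A i\<close> under a similarity with ratio \<open>s ^ j\<close>, where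
  \<open>1 \<le> j \<le> wt e\<close> for some arc \<open>e\<close>.  Since only finitely many \<open>i\<close> and \<open>j\<close> occur, the sizes of
  all balanced tiles of all parameters are comparable.
\<close>

lemma balanced_tile_size:
  obtains \<rho> D where "\<rho> > 0" "D \<ge> 0"
    "\<And>\<theta> k \<sigma>. \<theta> \<in> parameters G \<Longrightarrow> \<sigma> \<in> balanced_sequence G wt \<theta> k \<Longrightarrow>
      (\<exists>c. ball c \<rho> \<subseteq> param_tile G f A \<theta> k \<sigma>)"
    "\<And>\<theta> k \<sigma> x y. \<theta> \<in> parameters G \<Longrightarrow> \<sigma> \<in> balanced_sequence G wt \<theta> k \<Longrightarrow>
      x \<in> param_tile G f A \<theta> k \<sigma> \<Longrightarrow> y \<in> param_tile G f A \<theta> k \<sigma> \<Longrightarrow> dist x y \<le> D"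
proof -
  obtain r where r: "r > 0" "\<And>i. i \<in> verts G \<Longrightarrow> \<exists>c. ball c r \<subseteq> A i"
  proof (rule uniform_positive_witness[of "verts G" "\<lambda>i r. \<exists>c. ball c r \<subseteq> A i"])
    show "\<exists>r>0. \<exists>c. ball c r \<subseteq> A i" if "i \<in> verts G" for i
      using interior_component[OF that] mem_interior by blast
    show "\<exists>c. ball c r' \<subseteq> A i" if "\<exists>c. ball c r \<subseteq> A i" "r' \<le> r" for i r r'
      using that by (meson order_trans subset_ball)
  qed auto
  have "bounded (\<Union>i\<in>verts G. A i)"
    using compact_component compact_imp_bounded by (intro bounded_UN) auto
  then obtain d where d: "\<And>x y. x \<in> (\<Union>i\<in>verts G. A i) \<Longrightarrow> y \<in> (\<Union>i\<in>verts G. A i) \<Longrightarrow> dist x y \<le> d"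
    using bounded_two_points by metis
  define m where "m = sum wt (arcs G)"
  define Q where "Q = (\<lambda>j. s ^ j) ` {..m}"
  have Q: "finite Q" "Q \<noteq> {}" "\<And>q. q \<in> Q \<Longrightarrow> q > 0" unfolding Q_def using s_pos by auto
  have Min_Q: "Min Q > 0" using Q by simp
  have Max_Q: "Max Q > 0" using Q by (simp add: Max_gr_iff) (meson ex_in_conv)
  have tile: "\<exists>g q i. param_tile G f A \<theta> k \<sigma> = g ` A i \<and> i \<in> verts G \<and> bij g \<and> q \<in> Q
      \<and> similarity_with_ratio q g"
    if \<theta>: "\<theta> \<in> parameters G" and \<sigma>: "\<sigma> \<in> balanced_sequence G wt \<theta> k" for \<theta> k \<sigma>
  proof -
    have path: "\<sigma> \<in> finite_paths G" "snd \<sigma> \<noteq> []" using \<sigma> unfolding balanced_sequence_def by auto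
    then have arcs: "set (snd \<sigma>) \<subseteq> arcs G" by (auto simp: finite_paths_iff)
    define j where "j = path_weight wt (snd \<sigma>) - path_weight wt (param_prefix \<theta> k)"
    have "last (snd \<sigma>) \<in> arcs G" using arcs path(2) by (meson last_in_set subsetD)
    then have "wt (last (snd \<sigma>)) \<le> m" unfolding m_def by (rule wt_le_total)
    moreover have "0 < j" "j \<le> int (wt (last (snd \<sigma>)))"
      using \<sigma> unfolding balanced_sequence_def j_def by auto
    ultimately have "nat j \<in> {..m}" "s powi j = s ^ nat j"
      by (auto simp: power_int_def)
    then have "s powi j \<in> Q" unfolding Q_def by simp
    then show ?thesis
      using tile_map_similarity[OF \<theta> arcs] path_end_in_verts[OF path(1)]
      unfolding param_tile_def j_def by blast
  qed
  show ?thesis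
  proof (rule that[of "Min Q * r" "Max Q * max 0 d"])
    show "Min Q * r > 0" using Min_Q r(1) by simp
    show "Max Q * max 0 d \<ge> 0" using Max_Q by simp
  next
    fix \<theta> k \<sigma>
    assume "\<theta> \<in> parameters G" "\<sigma> \<in> balanced_sequence G wt \<theta> k"
    then obtain g q i where g: "param_tile G f A \<theta> k \<sigma> = g ` A i" "i \<in> verts G" "bij g" "q \<in> Q"
      "similarity_with_ratio q g"
      using tile by blast
    obtain c where "ball c r \<subseteq> A i" using r(2)[OF g(2)] by blast
    then have "g ` ball c r \<subseteq> g ` A i" by blast
    moreover have "g ` ball c r = ball (g c) (q * r)"
      by (rule similarity_image_ball[OF g(3) Q(3)[OF g(4)] g(5)])
    moreover have "Min Q * r \<le> q * r" using Q g(4) r(1) by (simp add: mult_right_mono)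
    then have "ball (g c) (Min Q * r) \<subseteq> ball (g c) (q * r)" by (rule subset_ball)
    ultimately have "ball (g c) (Min Q * r) \<subseteq> param_tile G f A \<theta> k \<sigma>"
      unfolding g(1) by order
    then show "\<exists>c. ball c (Min Q * r) \<subseteq> param_tile G f A \<theta> k \<sigma>" by blast
    fix x y
    assume "x \<in> param_tile G f A \<theta> k \<sigma>" "y \<in> param_tile G f A \<theta> k \<sigma>"
    then obtain x' y' where xy: "x = g x'" "y = g y'" "x' \<in> A i" "y' \<in> A i"
      unfolding g(1) by blast
    then have "dist x y = q * dist x' y'" using g(5) unfolding similarity_with_ratio_def by simp
    also have "\<dots> \<le> Max Q * max 0 d"
    proof (rule mult_mono)
      show "q \<le> Max Q" using Q(1) g(4) by (rule Max_ge)
      have "dist x' y' \<le> d" using xy(3,4) g(2) by (intro d) blast+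
      then show "dist x' y' \<le> max 0 d" by simp
    qed (use Max_Q in auto)
    finally show "dist x y \<le> Max Q * max 0 d" .
  qed
qed

text \<open>
  The patches are compact and exhaust the space, but this alone does not make a single patch
  cover a given ball: a point could lie on the boundary of every patch.  Local finiteness
  excludes this, since the finitely many tiles that meet the ball all appear at some stage.
\<close>

lemma balanced_patch_covers_ball:
  assumes "\<theta> \<in> filling_parameters G f A"
  obtains K where "K > 0" "cball 0 R \<subseteq> \<Union>(param_tile G f A \<theta> K ` balanced_sequence G wt \<theta> K)"
proof -
  have \<theta>: "\<theta> \<in> parameters G" using assms unfolding filling_parameters_def by blast
  let ?T = "balanced_tiling G f A wt \<theta>"
  let ?P = "\<lambda>k. param_tile G f A \<theta> k ` balanced_sequence G wt \<theta> k"
  note S = theta_sequence_balanced[OF \<theta>]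
  have mono: "?P j \<subseteq> ?P k" if "j \<le> k" for j k
    by (rule theta_sequence_patch_mono[OF \<theta> S that])
  obtain \<rho> D where size: "\<rho> > 0"
    "\<And>k \<sigma>. \<sigma> \<in> balanced_sequence G wt \<theta> k \<Longrightarrow> (\<exists>c. ball c \<rho> \<subseteq> param_tile G f A \<theta> k \<sigma>)"
    "\<And>k \<sigma> x y. \<sigma> \<in> balanced_sequence G wt \<theta> k \<Longrightarrow>
      x \<in> param_tile G f A \<theta> k \<sigma> \<Longrightarrow> y \<in> param_tile G f A \<theta> k \<sigma> \<Longrightarrow> dist x y \<le> D"
    using balanced_tile_size \<theta> by metis
  have T: "?T = (\<Union>k. ?P k)" unfolding balanced_tiling_def sequence_tiling_def ..
  define F where "F = {t \<in> ?T. t \<inter> cball 0 R \<noteq> {}}"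
  have "finite F"
    unfolding F_def
  proof (rule finite_fat_sets_meeting_ball[OF size(1)])
    show "\<exists>c. ball c \<rho> \<subseteq> t" if "t \<in> ?T" for t
      using that size(2) unfolding T by blast
    show "dist x y \<le> D" if "t \<in> ?T" "x \<in> t" "y \<in> t" for t x y
      using that size(3) unfolding T by blast
    show "interior (t \<inter> t') = {}" if "t \<in> ?T" "t' \<in> ?T" "t \<noteq> t'" for t t'
      using theta_sequence_tiles_disjoint_interior[OF \<theta> S] that
      unfolding balanced_tiling_def by blast
  qed
  have "\<forall>t\<in>F. \<exists>k. t \<in> ?P k" unfolding F_def T by blast
  then obtain k where k: "\<And>t. t \<in> F \<Longrightarrow> t \<in> ?P (k t)" by metis
  \<comment> \<open>the successor makes \<open>K\<close> positive, also when \<open>F\<close> is empty\<close>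
  define K where "K = Suc (Max (insert 0 (k ` F)))"
  have "F \<subseteq> ?P K"
  proof
    fix t assume t: "t \<in> F"
    then have "k t \<le> K" unfolding K_def using \<open>finite F\<close> by (intro le_SucI Max_ge) auto
    then show "t \<in> ?P K" using k[OF t] mono by blast
  qed
  then have "\<Union>F \<subseteq> \<Union>(?P K)" by (rule Union_mono)
  moreover have "cball 0 R \<subseteq> \<Union>F"
    using balanced_tiling_covers[OF assms] unfolding F_def by blast
  ultimately have "cball 0 R \<subseteq> \<Union>(?P K)" by order
  moreover have "K > 0" unfolding K_def by simp
  ultimately show ?thesis using that by blast
qed

text \<open>
  The first \<open>K\<close> arcs determine the vertex at index \<open>K\<close> only if \<open>K > 0\<close>: the vertex at index
  \<open>0\<close> is the head of the first arc.
\<close>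

lemma balanced_patch_cong:
  assumes "K > 0" and agree: "\<And>i. i < K \<Longrightarrow> \<theta> i = \<theta>' i"
  shows "param_tile G f A \<theta> K ` balanced_sequence G wt \<theta> K
    = param_tile G f A \<theta>' K ` balanced_sequence G wt \<theta>' K"
proof -
  obtain j where "K = Suc j" using \<open>K > 0\<close> by (metis not0_implies_Suc less_numeral_extra(3))
  then have "param_vertex G \<theta> K = param_vertex G \<theta>' K"
    using agree by (simp add: param_vertex_Suc)
  moreover have "param_prefix \<theta> K = param_prefix \<theta>' K"
    unfolding param_prefix_def using agree by simp
  ultimately show ?thesis
    unfolding param_tile_def balanced_sequence_def param_map_def by simp
qed

lemma param_dist_less_imp_agree:
  assumes "param_dist \<theta> \<theta>' < (1/2) ^ K" "i < K"
  shows "\<theta> i = \<theta>' i"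
proof (rule ccontr)
  assume ne: "\<theta> i \<noteq> \<theta>' i"
  define L where "L = (LEAST k. \<theta> k \<noteq> \<theta>' k)"
  have "L \<le> i" unfolding L_def using ne by (rule Least_le)
  then have "(1/2 :: real) ^ K \<le> (1/2) ^ Suc L"
    using assms(2) by (intro power_decreasing) auto
  moreover have "\<theta> \<noteq> \<theta>'" using ne by auto
  then have "param_dist \<theta> \<theta>' = (1/2) ^ Suc L" unfolding param_dist_def L_def by simp
  ultimately show False using assms(1) by simp
qed

text \<open>
  A tile of the common patch is matched with itself.  Every other tile stays away from the
  covered ball, hence projects close to the pole, and any far tile of the other tiling, which
  exists because that tiling covers the whole space, is an acceptable partner.
\<close>

lemma tiling_dist_le_of_common_patch:
  assumes M: "\<And>t t' :: 'a set. t \<noteq> {} \<Longrightarrow> t' \<noteq> {} \<Longrightarrow> (\<And>x. x \<in> t \<union> t' \<Longrightarrow> norm x \<ge> M) \<Longrightarrow>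
      hausdorff_dist round_dist (inverse_stereographic ` t) (inverse_stereographic ` t') \<le> \<eta>"
    and "\<eta> \<ge> 0" "R \<ge> 0" "R \<ge> M + D"
    and size: "\<rho> > 0"
      "\<And>\<theta> k \<sigma>. \<theta> \<in> parameters G \<Longrightarrow> \<sigma> \<in> balanced_sequence G wt \<theta> k \<Longrightarrow>
        (\<exists>c. ball c \<rho> \<subseteq> param_tile G f A \<theta> k \<sigma>)"
      "\<And>\<theta> k \<sigma> x y. \<theta> \<in> parameters G \<Longrightarrow> \<sigma> \<in> balanced_sequence G wt \<theta> k \<Longrightarrow>
        x \<in> param_tile G f A \<theta> k \<sigma> \<Longrightarrow> y \<in> param_tile G f A \<theta> k \<sigma> \<Longrightarrow> dist x y \<le> D"
    and fill: "\<theta> \<in> filling_parameters G f A" "\<theta>' \<in> filling_parameters G f A"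
    and patch: "P = param_tile G f A \<theta> K ` balanced_sequence G wt \<theta> K"
      "P = param_tile G f A \<theta>' K ` balanced_sequence G wt \<theta>' K" "cball 0 R \<subseteq> \<Union>P"
  shows "tiling_dist (balanced_tiling G f A wt \<theta>) (balanced_tiling G f A wt \<theta>') \<le> \<eta>"
proof -
  let ?T = "balanced_tiling G f A wt"
  let ?\<rho> = "\<lambda>t :: 'a set. inverse_stereographic ` t"
  have T: "?T \<phi> = (\<Union>k. param_tile G f A \<phi> k ` balanced_sequence G wt \<phi> k)" for \<phi>
    unfolding balanced_tiling_def sequence_tiling_def ..
  have params: "\<phi> \<in> parameters G" if "\<phi> \<in> filling_parameters G f A" for \<phi>
    using that unfolding filling_parameters_def by blast
  have tile_compact: "compact t \<and> t \<noteq> {}"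
    if "\<phi> \<in> filling_parameters G f A" "t \<in> ?T \<phi>" for \<phi> t
    using that param_tile_compact[OF params] unfolding T balanced_sequence_def by auto
  have far_tile: "\<exists>t\<in>?T \<phi>. \<forall>x\<in>t. norm x \<ge> M" if \<phi>: "\<phi> \<in> filling_parameters G f A" for \<phi>
  proof -
    obtain y :: 'a where y: "norm y = R" using vector_choose_size \<open>R \<ge> 0\<close> by blast
    obtain t where t: "t \<in> ?T \<phi>" "y \<in> t" using balanced_tiling_covers[OF \<phi>] by blast
    have "norm x \<ge> M" if "x \<in> t" for x
    proof -
      have "dist y x \<le> D" using size(3)[OF params[OF \<phi>]] t that unfolding T by blast
      then show ?thesis
        using norm_triangle_ineq2[of y x] y \<open>R \<ge> M + D\<close> by (simp add: dist_norm)
    qed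
    then show ?thesis using t by blast
  qed
  have near: "\<exists>t'\<in>?T \<psi>. hausdorff_dist round_dist (?\<rho> t) (?\<rho> t') \<le> \<eta>"
    if \<phi>: "\<phi> \<in> filling_parameters G f A" "P = param_tile G f A \<phi> K ` balanced_sequence G wt \<phi> K"
      and \<psi>: "\<psi> \<in> filling_parameters G f A" "P = param_tile G f A \<psi> K ` balanced_sequence G wt \<psi> K"
      and t: "t \<in> ?T \<phi>"
    for \<phi> \<psi> t
  proof (cases "t \<in> P")
    case True
    then have "t \<in> ?T \<psi>" unfolding \<psi>(2) T by blast
    moreover have "hausdorff_dist round_dist (?\<rho> t) (?\<rho> t) \<le> 0"
      using tile_compact[OF \<phi>(1) t]
      by (intro hausdorff_round_self inverse_stereographic_image_closed) auto
    ultimately show ?thesis using \<open>\<eta> \<ge> 0\<close> by (meson order_trans)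
  next
    case False
    note S = theta_sequence_balanced[OF params[OF \<phi>(1)]]
    have P_tiles: "P \<subseteq> ?T \<phi>" unfolding \<phi>(2) T by blast
    obtain c where c: "ball c \<rho> \<subseteq> t" using size(2)[OF params[OF \<phi>(1)]] t unfolding T by blast
    have diam: "dist x y \<le> D" if "x \<in> t" "y \<in> t" for x y
      using size(3)[OF params[OF \<phi>(1)]] t that unfolding T by blast
    have "finite P"
      unfolding \<phi>(2) using S unfolding theta_sequence_def pre_tree_def by blast
    have far: "norm x \<ge> R - D" if "x \<in> t" for x
    proof (rule fat_set_outside_covered_ball[OF size(1) c _ diam \<open>finite P\<close> patch(3) _ _ that])
      show "closed t" using tile_compact[OF \<phi>(1) t] compact_imp_closed by blast
      show "closed t'" if "t' \<in> P" for t'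
        using tile_compact[OF \<phi>(1)] P_tiles that compact_imp_closed by blast
      show "interior (t \<inter> t') = {}" if "t' \<in> P" for t'
        using theta_sequence_tiles_disjoint_interior[OF params[OF \<phi>(1)] S] t that P_tiles False
        unfolding balanced_tiling_def by blast
    qed
    obtain t' where t': "t' \<in> ?T \<psi>" "\<And>x. x \<in> t' \<Longrightarrow> norm x \<ge> M"
      using far_tile[OF \<psi>(1)] by blast
    have "hausdorff_dist round_dist (?\<rho> t) (?\<rho> t') \<le> \<eta>"
    proof (rule M)
      show "t \<noteq> {}" "t' \<noteq> {}" using tile_compact[OF \<phi>(1) t] tile_compact[OF \<psi>(1) t'(1)] by auto
      show "norm x \<ge> M" if "x \<in> t \<union> t'" for x
        using that far[of x] t'(2)[of x] \<open>R \<ge> M + D\<close> by auto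
    qed
    then show ?thesis using t'(1) by blast
  qed
  have closed: "?\<rho> ` ?T \<phi> \<subseteq> closed_subsets_of_sphere" "?\<rho> ` ?T \<phi> \<noteq> {}"
    if \<phi>: "\<phi> \<in> filling_parameters G f A" for \<phi>
    using tile_compact[OF \<phi>] inverse_stereographic_image_closed far_tile[OF \<phi>] by auto
  show ?thesis
    unfolding tiling_dist_def
  proof (rule hausdorff_dist_hyperspace_closure_le)
    show "\<exists>Y\<in>?\<rho> ` ?T \<theta>'. hausdorff_dist round_dist X Y \<le> \<eta>" if "X \<in> ?\<rho> ` ?T \<theta>" for X
      using that near[OF fill(1) patch(1) fill(2) patch(2)] by auto
    show "\<exists>X\<in>?\<rho> ` ?T \<theta>. hausdorff_dist round_dist Y X \<le> \<eta>" if "Y \<in> ?\<rho> ` ?T \<theta>'" for Y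
      using that near[OF fill(2) patch(2) fill(1) patch(1)] by auto
  qed (use closed fill in auto)
qed

lemma balanced_tiling_continuous:
  assumes \<theta>: "\<theta> \<in> filling_parameters G f A" and "\<epsilon> > 0"
  shows "\<exists>\<delta>>0. \<forall>\<theta>'\<in>filling_parameters G f A. param_dist \<theta> \<theta>' < \<delta> \<longrightarrow>
    tiling_dist (balanced_tiling G f A wt \<theta>) (balanced_tiling G f A wt \<theta>') < \<epsilon>"
proof -
  obtain \<rho> D where size: "\<rho> > 0" "D \<ge> 0"
    "\<And>\<theta> k \<sigma>. \<theta> \<in> parameters G \<Longrightarrow> \<sigma> \<in> balanced_sequence G wt \<theta> k \<Longrightarrow>
      (\<exists>c. ball c \<rho> \<subseteq> param_tile G f A \<theta> k \<sigma>)"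
    "\<And>\<theta> k \<sigma> x y. \<theta> \<in> parameters G \<Longrightarrow> \<sigma> \<in> balanced_sequence G wt \<theta> k \<Longrightarrow>
      x \<in> param_tile G f A \<theta> k \<sigma> \<Longrightarrow> y \<in> param_tile G f A \<theta> k \<sigma> \<Longrightarrow> dist x y \<le> D"
    using balanced_tile_size by blast
  obtain M where M: "\<And>t t' :: 'a set. t \<noteq> {} \<Longrightarrow> t' \<noteq> {} \<Longrightarrow>
      (\<And>x. x \<in> t \<union> t' \<Longrightarrow> norm x \<ge> M) \<Longrightarrow>
      hausdorff_dist round_dist (inverse_stereographic ` t) (inverse_stereographic ` t') \<le> \<epsilon> / 2"
    by (rule hausdorff_dist_far_sets[of "\<epsilon> / 2"]) (use \<open>\<epsilon> > 0\<close> in auto)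
  \<comment> \<open>tiles beyond \<open>R\<close> may reach inwards by \<open>D\<close> and must still be beyond \<open>M\<close>\<close>
  define R where "R = max 0 M + D"
  have R: "R \<ge> 0" "R \<ge> M + D" unfolding R_def using size(2) by auto
  obtain K where K: "K > 0"
    "cball 0 R \<subseteq> \<Union>(param_tile G f A \<theta> K ` balanced_sequence G wt \<theta> K)"
    using balanced_patch_covers_ball[OF \<theta>] by blast
  have "tiling_dist (balanced_tiling G f A wt \<theta>) (balanced_tiling G f A wt \<theta>') < \<epsilon>"
    if \<theta>': "\<theta>' \<in> filling_parameters G f A" and dist: "param_dist \<theta> \<theta>' < (1/2) ^ K" for \<theta>'
  proof -
    have "param_tile G f A \<theta> K ` balanced_sequence G wt \<theta> K
        = param_tile G f A \<theta>' K ` balanced_sequence G wt \<theta>' K"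
      by (rule balanced_patch_cong[OF K(1) param_dist_less_imp_agree[OF dist]])
    then have "tiling_dist (balanced_tiling G f A wt \<theta>) (balanced_tiling G f A wt \<theta>') \<le> \<epsilon> / 2"
      using \<open>\<epsilon> > 0\<close>
      by (intro tiling_dist_le_of_common_patch[OF M _ R size(1,3,4) \<theta> \<theta>' refl _ K(2)]) auto
    then show ?thesis using \<open>\<epsilon> > 0\<close> by simp
  qed
  then show ?thesis by (intro exI[of _ "(1/2) ^ K"]) auto
qed

end


section \<open>Continuity of the tiling map and its conjugacy with the shift\<close>

theorem theorem4:
  fixes n :: nat
    and G :: "(nat, 'e) pre_digraph"
    and f :: "'e \<Rightarrow> real ^ 'd \<Rightarrow> real ^ 'd"
    and A :: "nat \<Rightarrow> (real ^ 'd) set"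
    and s :: real
    and wt :: "'e \<Rightarrow> nat"
  assumes "GIFS n G f"
    and "attractor_components G f A"
    and "\<forall>i\<in>verts G. interior (A i) \<noteq> {}"
    and "\<forall>i\<in>verts G. \<forall>e\<in>out_arcs_at G i. \<forall>e'\<in>out_arcs_at G i. e \<noteq> e' \<longrightarrow>
           interior (f e ` A (head G e) \<inter> f e' ` A (head G e')) = {}"
    and "s > 0"
    and "\<forall>e\<in>arcs G. wt e > 0"
    and "\<forall>e\<in>arcs G. similarity_with_ratio (s ^ wt e) (f e)"
  shows "balanced_tiling G f A wt \<in> filling_parameters G f A \<rightarrow> tiling_space G f A wt
       \<and> (\<forall>\<theta>\<in>filling_parameters G f A. \<forall>\<epsilon>>0. \<exists>\<delta>>0. \<forall>\<theta>'\<in>filling_parameters G f A.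
            param_dist \<theta> \<theta>' < \<delta> \<longrightarrow>
            tiling_dist (balanced_tiling G f A wt \<theta>) (balanced_tiling G f A wt \<theta>') < \<epsilon>)
       \<and> (\<forall>\<theta>\<in>filling_parameters G f A.
            shift_map \<theta> \<in> filling_parameters G f A \<and>
            balanced_tiling G f A wt (shift_map \<theta>)
              = (\<lambda>t. f (\<theta> 0) ` t) ` level_one_tiling G f A wt \<theta>)"
proof -
  interpret fin_digraph G using assms(1) unfolding GIFS_def by blast
  interpret similarity_attractor G f A wt s
  proof unfold_locales
    show "bij (f e)" if "e \<in> arcs G" for e
      using assms(1) that unfolding GIFS_def invertible_contraction_def by blast
    show "interior (f e ` A (head G e) \<inter> f e' ` A (head G e')) = {}"
      if "e \<in> arcs G" "e' \<in> arcs G" "tail G e = tail G e'" "e \<noteq> e'" for e e'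
      by (rule assms(4)[rule_format, of "tail G e"])
        (use that tail_in_verts in \<open>auto simp: out_arcs_at_def\<close>)
  qed (use assms in auto)
  show ?thesis
  proof (intro conjI ballI allI impI)
    show "balanced_tiling G f A wt \<in> filling_parameters G f A \<rightarrow> tiling_space G f A wt"
      unfolding tiling_space_def by blast
  next
    fix \<theta> and \<epsilon> :: real
    assume "\<theta> \<in> filling_parameters G f A" "\<epsilon> > 0"
    then show "\<exists>\<delta>>0. \<forall>\<theta>'\<in>filling_parameters G f A. param_dist \<theta> \<theta>' < \<delta> \<longrightarrow>
        tiling_dist (balanced_tiling G f A wt \<theta>) (balanced_tiling G f A wt \<theta>') < \<epsilon>"
      by (rule balanced_tiling_continuous)
  next
    fix \<theta> assume "\<theta> \<in> filling_parameters G f A"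
    then show "shift_map \<theta> \<in> filling_parameters G f A"
      and "balanced_tiling G f A wt (shift_map \<theta>)
        = (\<lambda>t. f (\<theta> 0) ` t) ` level_one_tiling G f A wt \<theta>"
      using shift_in_filling_parameters balanced_tiling_shift
      unfolding filling_parameters_def by blast+
  qed
qed

end
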